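(* Let $\mathcal{X}$, $\mathcal{Y}$ be real, separable Hilbert spaces and let $\mu$ be a probability measure supported on $\mathcal{X}$ such that $\mathbb{E}_{x\sim\mu}\|x\|_{\mathcal{X}}^4<\infty$. Suppose $\Psi:\mathcal{X}\to\mathcal{Y}$ is a $\mu$-measurable, globally Lipschitz map. For any $\epsilon>0$, there are dimensions $d_{\mathcal{X}}=d_{\mathcal{X}}(\epsilon)\in\mathbb{N}$, $d_{\mathcal{Y}}=d_{\mathcal{Y}}(\epsilon)\in\mathbb{N}$, a requisite amount of data $N=N(d_{\mathcal{X}},d_{\mathcal{Y}})\in\mathbb{N}$, parameters $t,r,M$ depending on $d_{\mathcal{X}},d_{\mathcal{Y}}$ and $\epsilon$, and a zero-extended stacked neural network $\chi\in\mathcal{M}(d_{\mathcal{X}},d_{\mathcal{Y}};t,r,M)$ (whose weights and biases may depend on the data set $\{x_j\}_{j=1}^N$) such that $$\mathbb{E}_{\{x_j\}\sim\mu}\,\mathbb{E}_{x\sim\mu}\big(e_{NN}(x)^2\big)<\epsilon,\qquad e_{NN}(x)=\|(G_{\mathcal{Y}}\circ\chi\circ F_{\mathcal{X}})(x)-\Psi(x)\|_{\mathcal{Y}},$$ where $F_{\mathcal{X}}:\mathcal{X}\to\mathbb{R}^{d_{\mathcal{X}}}$ is the PCA encoder built from i.i.d. samples $x_1,\dots,x_N\sim\mu$, $G_{\mathcal{Y}}:\mathbb{R}^{d_{\mathcal{Y}}}\to\mathcal{Y}$ is the PCA decoder built from $y_j=\Psi(x_j)$, $j=1,\dots,N$,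 and the outer expectation is over the data set $\{x_j\}_{j=1}^N$ while the inner one is over an independent $x\sim\mu$.
   Context: PCA. Let $\mathcal{H}$ be a real separable Hilbert space and $u_1,\dots,u_N\in\mathcal{H}$ data. The empirical non-centered covariance is $C_N=\frac1N\sum_{j=1}^N u_j\otimes u_j$, with orthonormal eigenvectors $\phi_{1,N},\dots,\phi_{N,N}$ and eigenvalues $\lambda_{1,N}\ge\dots\ge\lambda_{N,N}\ge 0$. For $d\le N$ the PCA encoder of dimension $d$ is $F_{\mathcal{H}}:\mathcal{H}\to\mathbb{R}^d$, $F_{\mathcal{H}}(u)=(\langle u,\phi_{1,N}\rangle,\dots,\langle u,\phi_{d,N}\rangle)^T$, and the PCA decoder is $G_{\mathcal{H}}:\mathbb{R}^d\to\mathcal{H}$, $G_{\mathcal{H}}(s)=\sum_{j=1}^d s_j\phi_{j,N}$. $F_{\mathcal{X}}$ is the encoder with $\mathcal{H}=\mathcal{X}$, $u_j=x_j$, $d=d_{\mathcal{X}}$; $G_{\mathcal{Y}}$ is the decoder with $\mathcal{H}=\mathcal{Y}$, $u_j=y_j=\Psi(x_j)$, $d=d_{\mathcal{Y}}$. Neural networks. Let $\sigma(s)=\max\{0,s\}$ be the ReLU function, applied entrywise to vectors. For a matrix or vector $W$, $|W|_0$ is its number of nonzero entries. $\mathcal{M}(n;t,r)$ is the set of functions $\chi:\mathbb{R}^n\to\mathbb{R}$ of the form $\chi(s)=W_t\sigma(\cdots\sigma(W_2\sigma(W_1s+b_1)+b_2))+b_t$ with weight matrices $W_1,\dots,W_t$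 (not necessarily square) and bias vectors $b_1,\dots,b_t$ satisfying $\sum_{k=1}^t(|W_k|_0+|b_k|_0)\le r$; $t\ge1$ is the number of layers. The stacked networks $\mathcal{M}(n,m;t,r)$ are the maps $\chi=(\chi^{(1)},\dots,\chi^{(m)})^T:\mathbb{R}^n\to\mathbb{R}^m$ with $\chi^{(j)}\in\mathcal{M}(n;t^{(j)},r^{(j)})$, $t^{(j)}\le t$, $r^{(j)}\le r$. For $M>0$, the zero-extended stacked networks $\mathcal{M}(n,m;t,r,M)$ are the maps $\chi$ such that for some $\tilde\chi\in\mathcal{M}(n,m;t,r)$, $\chi(s)=\tilde\chi(s)$ for $s\in[-M,M]^n$ and $\chi(s)=0$ for $s\notin[-M,M]^n$. *)

theory Defs
  imports "HOL-Probability.Probability" "Jordan_Normal_Form.Matrix"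
begin

text \<open>
  Vectors in $\mathbb{R}^d$ with $d$ varying are elements of \<open>carrier_vec d\<close>, and all indices
  start at 0. The inner product of a Hilbert space is written \<open>inner u v\<close>, because Matrix
  also declares the infix dot for its own scalar product.
\<close>

definition emp_cov :: "nat \<Rightarrow> (nat \<Rightarrow> 'h::real_inner) \<Rightarrow> 'h \<Rightarrow> 'h" where
  "emp_cov N u v = (1 / real N) *\<^sub>R (\<Sum>j<N. inner (u j) v *\<^sub>R u j)"

text \<open>
  \<open>phi 0, \<dots>, phi (N - 1)\<close> are orthonormal eigenvectors of the empirical covariance, sorted by
  decreasing eigenvalue. If the space has dimension less than \<open>N\<close>, there are only \<open>m < N\<close> of them:
  they form a basis and the list is padded by zero vectors. Otherwise \<open>m = N\<close>. The last condition
  says that the eigenvalues \<open>lam j\<close> exhaust the nonzero spectrum, counted with multiplicity;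
  without it \<open>phi\<close> could consist of kernel vectors only.
\<close>
definition pca_eigensystem ::
  "nat \<Rightarrow> (nat \<Rightarrow> 'h::real_inner) \<Rightarrow> (nat \<Rightarrow> real) \<Rightarrow> (nat \<Rightarrow> 'h) \<Rightarrow> bool" where
  "pca_eigensystem N u lam phi \<longleftrightarrow>
     (\<exists>m\<le>N. (\<forall>i<m. \<forall>j<m. inner (phi i) (phi j) = (if i = j then 1 else 0)) \<and>
            (\<forall>j. m \<le> j \<and> j < N \<longrightarrow> phi j = 0 \<and> lam j = 0) \<and>
            (m = N \<or> (\<forall>v. (\<forall>j<m. inner (phi j) v = 0) \<longrightarrow> v = 0))) \<and>
     (\<forall>j<N. emp_cov N u (phi j) = lam j *\<^sub>R phi j) \<and>
     (\<forall>i j. i \<le> j \<and> j < N \<longrightarrow> lam j \<le> lam i) \<and>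
     (\<forall>j<N. 0 \<le> lam j) \<and>
     (\<forall>v. (\<forall>j<N. inner (phi j) v = 0) \<longrightarrow> emp_cov N u v = 0)"

definition is_pca_basis :: "nat \<Rightarrow> (nat \<Rightarrow> 'h::real_inner) \<Rightarrow> (nat \<Rightarrow> 'h) \<Rightarrow> bool" where
  "is_pca_basis N u phi \<longleftrightarrow> (\<exists>lam. pca_eigensystem N u lam phi)"

definition pca_encoder :: "nat \<Rightarrow> (nat \<Rightarrow> 'h::real_inner) \<Rightarrow> 'h \<Rightarrow> real vec" where
  "pca_encoder d phi u = Matrix.vec d (\<lambda>j. inner u (phi j))"

definition pca_decoder :: "nat \<Rightarrow> (nat \<Rightarrow> 'h::real_inner) \<Rightarrow> real vec \<Rightarrow> 'h" where
  "pca_decoder d phi s = (\<Sum>j<d. vec_index s j *\<^sub>R phi j)"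

definition relu :: "real \<Rightarrow> real" where
  "relu s = max 0 s"

type_synonym layer = "real mat \<times> real vec"

text \<open>\<open>layers_fit n ls m\<close>: the shapes compose to a map from dimension \<open>n\<close> to dimension \<open>m\<close>.\<close>
fun layers_fit :: "nat \<Rightarrow> layer list \<Rightarrow> nat \<Rightarrow> bool" where
  "layers_fit n [] m \<longleftrightarrow> n = m"
| "layers_fit n ((W, b) # ls) m \<longleftrightarrow>
     W \<in> carrier_mat (dim_vec b) n \<and> layers_fit (dim_vec b) ls m"

text \<open>No activation is applied after the last layer.\<close>
fun net_eval :: "layer list \<Rightarrow> real vec \<Rightarrow> real vec" where
  "net_eval [] s = s"
| "net_eval [(W, b)] s = W *\<^sub>v s + b"
| "net_eval ((W, b) # l # ls) s = net_eval (l # ls) (map_vec relu (W *\<^sub>v s + b))"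

definition nnz_mat :: "real mat \<Rightarrow> nat" where
  "nnz_mat W = card {(i, j). i < dim_row W \<and> j < dim_col W \<and> W $$ (i, j) \<noteq> 0}"

definition nnz_vec :: "real vec \<Rightarrow> nat" where
  "nnz_vec b = card {i. i < dim_vec b \<and> vec_index b i \<noteq> 0}"

definition net_size :: "layer list \<Rightarrow> nat" where
  "net_size ls = (\<Sum>(W, b)\<leftarrow>ls. nnz_mat W + nnz_vec b)"

text \<open>
  The classes $\mathcal{M}(n;t,r)$, $\mathcal{M}(n,m;t,r)$ and $\mathcal{M}(n,m;t,r,M)$. Their members
  are only determined on \<open>carrier_vec n\<close>.
\<close>

definition nets :: "nat \<Rightarrow> nat \<Rightarrow> nat \<Rightarrow> (real vec \<Rightarrow> real) set" where
  "nets n t r = {f. \<exists>ls. length ls = t \<and> 1 \<le> t \<and> layers_fit n ls 1 \<and> net_size ls \<le> r \<and>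
     (\<forall>s\<in>carrier_vec n. f s = vec_index (net_eval ls s) 0)}"

definition stacked_nets :: "nat \<Rightarrow> nat \<Rightarrow> nat \<Rightarrow> nat \<Rightarrow> (real vec \<Rightarrow> real vec) set" where
  "stacked_nets n m t r = {f.
     (\<forall>s\<in>carrier_vec n. f s \<in> carrier_vec m) \<and>
     (\<forall>j<m. \<exists>t'\<le>t. \<exists>r'\<le>r. (\<lambda>s. vec_index (f s) j) \<in> nets n t' r')}"

definition zero_ext_nets ::
  "nat \<Rightarrow> nat \<Rightarrow> nat \<Rightarrow> nat \<Rightarrow> real \<Rightarrow> (real vec \<Rightarrow> real vec) set" where
  "zero_ext_nets n m t r M = {f. \<exists>g\<in>stacked_nets n m t r. \<forall>s\<in>carrier_vec n.
     f s = (if \<forall>i<n. vec_index s i \<in> {-M..M} then g s else 0\<^sub>v m)}"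

text \<open>
  The eigenvectors are only determined up to sign, and up to rotation within an eigenspace, so a
  choice of them need not depend measurably on the data. The expectation over the data is therefore
  the upper integral. It bounds the Lebesgue integral from above, with equality for measurable
  integrands.
\<close>
definition upper_expectation :: "'a measure \<Rightarrow> ('a \<Rightarrow> ennreal) \<Rightarrow> ennreal" where
  "upper_expectation D f =
     (INF g\<in>{g \<in> borel_measurable D. \<forall>x\<in>space D. f x \<le> g x}. \<integral>\<^sup>+x. g x \<partial>D)"

lemma nn_integral_le_upper_expectation: "(\<integral>\<^sup>+x. f x \<partial>D) \<le> upper_expectation D f"
  unfolding upper_expectation_def by (intro INF_greatest nn_integral_mono) auto

lemma upper_expectation_eq_nn_integral:
  assumes "f \<in> borel_measurable D"
  shows "upper_expectation D f = (\<integral>\<^sup>+x. f x \<partial>D)"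
  by (intro antisym nn_integral_le_upper_expectation)
     (use assms in \<open>auto simp: upper_expectation_def intro!: INF_lower\<close>)

end

theory Submission
  imports Defs
begin

text \<open>
  Write \<open>P\<close> for the projection onto the first \<open>d\<close> empirical PCA directions in the input space
  and \<open>Q\<close> for its counterpart of rank \<open>m\<close> in the output space. As the decoder after the
  encoder is \<open>P\<close>, the network only has to imitate the latent map \<open>s \<mapsto> \<langle>\<Psi> (\<Sum>\<^sub>i s\<^sub>i \<phi>\<^sub>i), \<psi>\<^sub>j\<rangle>\<close>
  on the cube. If it does so up to \<open>\<delta>\<close> in each coordinate, then wherever the code of \<open>x\<close> lies
  in the cube the error is at most \<open>m \<delta> + L \<parallel>x - P x\<parallel> + \<parallel>\<Psi> x - Q (\<Psi> x)\<parallel>\<close>; elsewhere \<open>\<parallel>x\<parallel> > M\<close>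
  and the error is \<open>\<parallel>\<Psi> x\<parallel>\<close>, whose square has a small integral over that region when \<open>M\<close> is
  large (\<open>pointwise_error\<close>).

  The latent maps are Lipschitz and bounded on the cube, with constants that do not depend on
  the data. So it suffices to find one depth and one size that serve all Lipschitz functions
  with given constants (\<open>relu_nets_approximate_lipschitz\<close>). The McShane envelope \<open>Max\<^sub>p (c p -
  L \<parallel>s - p\<parallel>\<^sub>1)\<close> over a finite grid of points \<open>p\<close> approximates such a function when the values
  \<open>c p\<close> are close to those of the function. Rounding them to a finite set leaves finitely many
  envelopes in total. Each is a ReLU network, and the maxima of their depths and sizes are the
  bounds.

  There remains the PCA error \<open>\<integral> \<parallel>x - P x\<parallel>\<^sup>2 d\<mu>\<close> (\<open>pca_population_error\<close>). Empirically, \<open>P\<close> is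
  the best projection of its rank, hence no worse than the projection onto the first \<open>d\<close>
  vectors of a fixed complete orthonormal system. The mean error of that projection does not
  depend on \<open>N\<close> and tends to 0 as \<open>d\<close> grows. It remains to pass from the empirical to the
  population error, uniformly over all projections because \<open>P\<close> depends on the data. Up to a
  small tail, the data may be replaced by their projection to a space of fixed dimension \<open>K\<close>.
  There the error of any projection is a combination of \<open>K\<^sup>2\<close> second moments with coefficients
  in \<open>[-1, 1]\<close>, so the deviation is at most the sum of the deviations of these moments from
  their empirical averages. That sum is a measurable function of the sample, and its mean is
  \<open>O(1 / sqrt N)\<close> by the fourth-moment assumption. The same argument applies to the outputs \<open>\<Psi>
  x\<close>. All these bounds are uniform in the choice of eigenvectors, so that choice may depend on
  the data in a nonmeasurable way.
\<close>

section \<open>ReLU networks approximate Lipschitz functions on a cube\<close>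

text \<open>
  Level \<open>k\<close> consists of the scalar outputs of networks with \<open>k\<close> hidden layers. Lower-level
  networks enter as functions rather than as lists of layers, so the closure properties reduce
  to manipulations of linear combinations; the weights become matrices in
  \<open>relu_class_realised\<close>. Membership constrains a function only on \<open>carrier_vec n\<close>, as it does
  for \<open>nets\<close>.
\<close>
fun relu_class :: "nat \<Rightarrow> nat \<Rightarrow> (real vec \<Rightarrow> real) set" where
  "relu_class n 0 =
     {f. \<exists>a b. \<forall>s\<in>carrier_vec n. f s = (\<Sum>i<n. a i * vec_index s i) + b}"
| "relu_class n (Suc k) =
     {f. \<exists>H w b. finite H \<and> H \<subseteq> relu_class n k \<and>
           (\<forall>s\<in>carrier_vec n. f s = (\<Sum>h\<in>H. w h * relu (h s)) + b)}"

lemma relu_class_zeroD: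
  "f \<in> relu_class n 0 \<Longrightarrow> \<exists>a b. \<forall>s\<in>carrier_vec n. f s = (\<Sum>i<n. a i * vec_index s i) + b"
  by simp

lemma relu_class_SucD:
  "f \<in> relu_class n (Suc k) \<Longrightarrow> \<exists>H w b. finite H \<and> H \<subseteq> relu_class n k \<and>
     (\<forall>s\<in>carrier_vec n. f s = (\<Sum>h\<in>H. w h * relu (h s)) + b)"
  by simp

lemma relu_class_zeroI:
  "(\<And>s. s \<in> carrier_vec n \<Longrightarrow> f s = (\<Sum>i<n. a i * vec_index s i) + b) \<Longrightarrow> f \<in> relu_class n 0"
  unfolding relu_class.simps by blast

lemma relu_class_SucI:
  "finite H \<Longrightarrow> H \<subseteq> relu_class n k \<Longrightarrow>
    (\<And>s. s \<in> carrier_vec n \<Longrightarrow> f s = (\<Sum>h\<in>H. w h * relu (h s)) + b) \<Longrightarrow> f \<in> relu_class n (Suc k)"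
  unfolding relu_class.simps by blast

lemma layers_fit_snoc:
  "layers_fit n ls p \<Longrightarrow> W \<in> carrier_mat (dim_vec b) p \<Longrightarrow> layers_fit n (ls @ [(W, b)]) (dim_vec b)"
proof (induction ls arbitrary: n)
  case (Cons l ls)
  then show ?case by (cases l) simp
qed simp

lemma net_eval_snoc:
  "ls \<noteq> [] \<Longrightarrow> net_eval (ls @ [(W, b)]) s = W *\<^sub>v map_vec relu (net_eval ls s) + b"
proof (induction ls arbitrary: s)
  case (Cons l ls)
  obtain V c where l: "l = (V, c)" by (cases l)
  show ?case
  proof (cases ls)
    case Nil
    then show ?thesis by (simp add: l)
  next
    case (Cons l' ls')
    then show ?thesis using Cons.IH by (simp add: l)
  qed
qed simp

text \<open>
  A whole list has to be realised at once: the induction step collects the functions that any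
  entry of the list refers to into one layer of width \<open>length hs\<close>, from which all entries are
  read off by a single affine map.
\<close>
lemma relu_class_realised:
  assumes "set gs \<subseteq> relu_class n k"
  shows "\<exists>ls. length ls = Suc k \<and> layers_fit n ls (length gs) \<and>
           (\<forall>s\<in>carrier_vec n. net_eval ls s = Matrix.vec (length gs) (\<lambda>i. (gs ! i) s))"
  using assms
proof (induction k arbitrary: gs)
  case 0
  then have "\<forall>i<length gs. \<exists>a b. \<forall>s\<in>carrier_vec n. (gs ! i) s = (\<Sum>l<n. a l * vec_index s l) + b"
  proof (intro allI impI)
    fix i assume "i < length gs"
    then have "gs ! i \<in> relu_class n 0" using 0 nth_mem by blast
    then show "\<exists>a b. \<forall>s\<in>carrier_vec n. (gs ! i) s = (\<Sum>l<n. a l * vec_index s l) + b"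
      by (rule relu_class_zeroD)
  qed
  then obtain a b where "\<forall>i<length gs. \<forall>s\<in>carrier_vec n.
      (gs ! i) s = (\<Sum>l<n. a i l * vec_index s l) + b i"
    by metis
  then have ab: "(gs ! i) s = (\<Sum>l<n. a i l * vec_index s l) + b i"
    if "i < length gs" "s \<in> carrier_vec n" for i s
    using that by blast
  let ?W = "Matrix.mat (length gs) n (\<lambda>(i, l). a i l)" and ?b = "Matrix.vec (length gs) b"
  show ?case
    by (intro exI[of _ "[(?W, ?b)]"])
       (auto simp: ab scalar_prod_def lessThan_atLeast0 intro!: eq_vecI)
next
  case (Suc k)
  define rep where "rep f H w b \<longleftrightarrow> finite H \<and> H \<subseteq> relu_class n k \<and>
      (\<forall>s\<in>carrier_vec n. f s = (\<Sum>h\<in>H. w h * relu (h s)) + b)" for f H w b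
  have "\<exists>H w b. rep (gs ! i) H w b" if "i < length gs" for i
  proof -
    have "gs ! i \<in> relu_class n (Suc k)" using Suc.prems nth_mem that by blast
    then show ?thesis unfolding rep_def by (rule relu_class_SucD)
  qed
  then obtain H w b where rep: "\<And>i. i < length gs \<Longrightarrow> rep (gs ! i) (H i) (w i) (b i)"
    by metis
  have H: "finite (H i)" "H i \<subseteq> relu_class n k" if "i < length gs" for i
    using rep[OF that] by (auto simp: rep_def)
  have g: "(gs ! i) s = (\<Sum>h\<in>H i. w i h * relu (h s)) + b i"
    if "i < length gs" "s \<in> carrier_vec n" for i s
    using rep[OF that(1)] that(2) by (auto simp: rep_def)
  define U where "U = (\<Union>i<length gs. H i)"
  have "finite U" and U: "U \<subseteq> relu_class n k"
    using H by (auto simp: U_def)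
  then obtain hs where hs: "set hs = U" "distinct hs"
    using finite_distinct_list by metis
  obtain ls where ls: "length ls = Suc k" "layers_fit n ls (length hs)"
    "\<And>s. s \<in> carrier_vec n \<Longrightarrow> net_eval ls s = Matrix.vec (length hs) (\<lambda>i. (hs ! i) s)"
    using Suc.IH[of hs] U hs by auto
  have "ls \<noteq> []" using ls(1) by auto
  let ?W = "Matrix.mat (length gs) (length hs)
      (\<lambda>(i, j). if hs ! j \<in> H i then w i (hs ! j) else 0)"
  let ?b = "Matrix.vec (length gs) b"
  have eval: "net_eval (ls @ [(?W, ?b)]) s = Matrix.vec (length gs) (\<lambda>i. (gs ! i) s)"
    if s: "s \<in> carrier_vec n" for s
  proof (rule eq_vecI)
    fix i assume "i < dim_vec (Matrix.vec (length gs) (\<lambda>i. (gs ! i) s))"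
    then have i: "i < length gs" by simp
    have "vec_index (net_eval (ls @ [(?W, ?b)]) s) i =
        (\<Sum>j<length hs. (if hs ! j \<in> H i then w i (hs ! j) else 0) * relu ((hs ! j) s)) + b i"
      using \<open>ls \<noteq> []\<close> i by (subst net_eval_snoc)
        (auto simp: ls(3)[OF s] scalar_prod_def lessThan_atLeast0 intro!: sum.cong)
    also have "(\<Sum>j<length hs. (if hs ! j \<in> H i then w i (hs ! j) else 0) * relu ((hs ! j) s)) =
        (\<Sum>h\<in>U. (if h \<in> H i then w i h else 0) * relu (h s))"
      using hs by (intro sum.reindex_bij_betw[where h = "(!) hs"
            and g = "\<lambda>h. (if h \<in> H i then w i h else 0) * relu (h s)"]) (auto simp: bij_betw_nth)
    also have "\<dots> = (\<Sum>h\<in>H i. w i h * relu (h s))"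
      using \<open>finite U\<close> i by (intro sum.mono_neutral_cong_right) (auto simp: U_def)
    finally show "vec_index (net_eval (ls @ [(?W, ?b)]) s) i =
        vec_index (Matrix.vec (length gs) (\<lambda>i. (gs ! i) s)) i"
      using g i s by simp
  qed (use \<open>ls \<noteq> []\<close> in \<open>simp add: net_eval_snoc\<close>)
  show ?case
    using ls(1,2) eval layers_fit_snoc[of n ls "length hs" ?W ?b]
    by (intro exI[of _ "ls @ [(?W, ?b)]"]) auto
qed

corollary relu_class_in_nets:
  assumes "f \<in> relu_class n k"
  shows "\<exists>t r. f \<in> nets n t r"
proof -
  obtain ls where "length ls = Suc k" "layers_fit n ls (length [f])"
     "\<forall>s\<in>carrier_vec n. net_eval ls s = Matrix.vec (length [f]) (\<lambda>i. ([f] ! i) s)"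
    using relu_class_realised[of "[f]" n k] assms by auto
  then have "f \<in> nets n (Suc k) (net_size ls)"
    unfolding nets_def by (auto intro!: exI[of _ ls])
  then show ?thesis by blast
qed

lemma relu_class_lincomb:
  assumes "f \<in> relu_class n k" "g \<in> relu_class n k"
  shows "(\<lambda>s. c * f s + d * g s) \<in> relu_class n k"
proof (cases k)
  case 0
  obtain a b where f: "\<forall>s\<in>carrier_vec n. f s = (\<Sum>i<n. a i * vec_index s i) + b"
    using assms(1) 0 by auto
  obtain a' b' where g: "\<forall>s\<in>carrier_vec n. g s = (\<Sum>i<n. a' i * vec_index s i) + b'"
    using assms(2) 0 by auto
  have "c * f s + d * g s = (\<Sum>i<n. (c * a i + d * a' i) * vec_index s i) + (c * b + d * b')"
    if "s \<in> carrier_vec n" for s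
    using f g that by (simp add: algebra_simps sum.distrib sum_distrib_left)
  then show ?thesis unfolding 0 by (rule relu_class_zeroI)
next
  case (Suc j)
  obtain H w b where f: "finite H" "H \<subseteq> relu_class n j"
     "\<forall>s\<in>carrier_vec n. f s = (\<Sum>h\<in>H. w h * relu (h s)) + b"
    using assms(1) Suc by auto
  obtain H' w' b' where g: "finite H'" "H' \<subseteq> relu_class n j"
     "\<forall>s\<in>carrier_vec n. g s = (\<Sum>h\<in>H'. w' h * relu (h s)) + b'"
    using assms(2) Suc by auto
  define v where "v h = (if h \<in> H then c * w h else 0) + (if h \<in> H' then d * w' h else 0)" for h
  have "c * f s + d * g s = (\<Sum>h\<in>H \<union> H'. v h * relu (h s)) + (c * b + d * b')"
    if s: "s \<in> carrier_vec n" for s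
  proof -
    have "(\<Sum>h\<in>H. c * (w h * relu (h s))) = (\<Sum>h\<in>H \<union> H'. (if h \<in> H then c * w h else 0) * relu (h s))"
      using f(1) g(1) by (intro sum.mono_neutral_cong_left) auto
    moreover have "(\<Sum>h\<in>H'. d * (w' h * relu (h s))) =
        (\<Sum>h\<in>H \<union> H'. (if h \<in> H' then d * w' h else 0) * relu (h s))"
      using f(1) g(1) by (intro sum.mono_neutral_cong_left) auto
    ultimately show ?thesis
      using f(3) g(3) s by (simp add: v_def algebra_simps sum.distrib sum_distrib_left)
  qed
  then show ?thesis
    unfolding Suc using f(1,2) g(1,2)
    by (intro relu_class_SucI[where H = "H \<union> H'" and w = v and b = "c * b + d * b'"]) auto
qed

lemma relu_class_relu: "f \<in> relu_class n k \<Longrightarrow> (\<lambda>s. relu (f s)) \<in> relu_class n (Suc k)"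
  by (rule relu_class_SucI[where H = "{f}" and w = "\<lambda>_. 1" and b = 0]) auto

text \<open>
  The identity \<open>x = relu x - relu (- x)\<close> passes a value through an additional layer. It lets
  networks of different depths be combined.
\<close>
lemma relu_class_Suc: "relu_class n k \<subseteq> relu_class n (Suc k)"
proof
  fix f assume f: "f \<in> relu_class n k"
  have "(\<lambda>s. 1 * relu (f s) + (- 1) * relu ((- 1) * f s + 0 * f s)) \<in> relu_class n (Suc k)"
    by (intro relu_class_lincomb relu_class_relu f)
  also have "(\<lambda>s. 1 * relu (f s) + (- 1) * relu ((- 1) * f s + 0 * f s)) = f"
    by (auto simp: relu_def)
  finally show "f \<in> relu_class n (Suc k)" .
qed

lemma relu_class_mono: "k \<le> l \<Longrightarrow> relu_class n k \<subseteq> relu_class n l"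
  by (rule lift_Suc_mono_le[of "relu_class n"]) (use relu_class_Suc in auto)

definition relu_functions :: "nat \<Rightarrow> (real vec \<Rightarrow> real) set" where
  "relu_functions n = (\<Union>k. relu_class n k)"

lemma relu_functions_in_nets: "f \<in> relu_functions n \<Longrightarrow> \<exists>t r. f \<in> nets n t r"
  unfolding relu_functions_def using relu_class_in_nets by blast

lemma relu_functions_affine:
  "(\<lambda>s. (\<Sum>i<n. a i * vec_index s i) + b) \<in> relu_functions n"
proof -
  have "(\<lambda>s. (\<Sum>i<n. a i * vec_index s i) + b) \<in> relu_class n 0"
    by (rule relu_class_zeroI) (rule refl)
  then show ?thesis unfolding relu_functions_def by blast
qed

lemma relu_functions_lincomb:
  assumes "f \<in> relu_functions n" "g \<in> relu_functions n"
  shows "(\<lambda>s. c * f s + d * g s) \<in> relu_functions n"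
proof -
  obtain k l where "f \<in> relu_class n k" "g \<in> relu_class n l"
    using assms by (auto simp: relu_functions_def)
  then have "f \<in> relu_class n (max k l)" "g \<in> relu_class n (max k l)"
    using relu_class_mono[of k "max k l" n] relu_class_mono[of l "max k l" n] by auto
  then have "(\<lambda>s. c * f s + d * g s) \<in> relu_class n (max k l)"
    by (rule relu_class_lincomb)
  then show ?thesis by (auto simp: relu_functions_def)
qed

lemma relu_functions_const: "(\<lambda>s. b) \<in> relu_functions n"
  using relu_functions_affine[where n = n and a = "\<lambda>_. 0" and b = b] by simp

lemma relu_functions_max:
  assumes "f \<in> relu_functions n" "g \<in> relu_functions n"
  shows "(\<lambda>s. max (f s) (g s)) \<in> relu_functions n"
proof -
  have "(\<lambda>s. 1 * f s + (- 1) * g s) \<in> relu_functions n"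
    using assms by (rule relu_functions_lincomb)
  then have "(\<lambda>s. relu (1 * f s + (- 1) * g s)) \<in> relu_functions n"
    using relu_class_relu by (fastforce simp: relu_functions_def simp del: relu_class.simps)
  with assms(2) have "(\<lambda>s. 1 * g s + 1 * relu (1 * f s + (- 1) * g s)) \<in> relu_functions n"
    by (rule relu_functions_lincomb)
  also have "(\<lambda>s. 1 * g s + 1 * relu (1 * f s + (- 1) * g s)) = (\<lambda>s. max (f s) (g s))"
    by (auto simp: relu_def)
  finally show ?thesis .
qed

lemma relu_functions_sum:
  assumes "finite A" "\<And>i. i \<in> A \<Longrightarrow> f i \<in> relu_functions n"
  shows "(\<lambda>s. \<Sum>i\<in>A. f i s) \<in> relu_functions n"
  using assms
proof (induction A)
  case empty
  then show ?case by (simp add: relu_functions_const)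
next
  case (insert i A)
  then have "(\<lambda>s. 1 * f i s + 1 * (\<Sum>i\<in>A. f i s)) \<in> relu_functions n"
    by (intro relu_functions_lincomb) auto
  then show ?case using insert by simp
qed

lemma relu_functions_Max:
  assumes "finite A" "A \<noteq> {}" "\<And>i. i \<in> A \<Longrightarrow> f i \<in> relu_functions n"
  shows "(\<lambda>s. Max ((\<lambda>i. f i s) ` A)) \<in> relu_functions n"
  using assms
proof (induction A rule: finite_ne_induct)
  case (insert i A)
  then have "(\<lambda>s. max (f i s) (Max ((\<lambda>i. f i s) ` A))) \<in> relu_functions n"
    by (intro relu_functions_max) auto
  then show ?case using insert by simp
qed auto

lemma relu_functions_abs_coord:
  assumes "i < n"
  shows "(\<lambda>s. \<bar>vec_index s i - p\<bar>) \<in> relu_functions n"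
proof -
  have coord: "(\<lambda>s. c * vec_index s i + b) \<in> relu_functions n" for c b :: real
    using relu_functions_affine[where n = n and a = "\<lambda>l. if l = i then c else 0" and b = b] assms
    by (simp add: if_distrib[where f = "\<lambda>x. x * _"] cong: if_cong)
  have "(\<lambda>s. max (1 * vec_index s i + (- p)) ((- 1) * vec_index s i + p)) \<in> relu_functions n"
    by (intro relu_functions_max coord)
  also have "(\<lambda>s. max (1 * vec_index s i + (- p)) ((- 1) * vec_index s i + p)) =
      (\<lambda>s. \<bar>vec_index s i - p\<bar>)"
    by (auto simp: fun_eq_iff)
  finally show ?thesis .
qed

text \<open>
  For \<open>L \<ge> 0\<close>, the smallest function that is \<open>L\<close>-Lipschitz for the 1-norm and at least \<open>c\<close> on
  \<open>G\<close>. If \<open>c\<close> is itself \<open>L\<close>-Lipschitz on \<open>G\<close>, this is its McShane extension.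
\<close>
definition mcshane :: "nat \<Rightarrow> real \<Rightarrow> real vec set \<Rightarrow> (real vec \<Rightarrow> real) \<Rightarrow> real vec \<Rightarrow> real" where
  "mcshane n L G c s = Max ((\<lambda>p. c p - L * (\<Sum>i<n. \<bar>vec_index s i - vec_index p i\<bar>)) ` G)"

lemma mcshane_relu:
  assumes "finite G" "G \<noteq> {}"
  shows "mcshane n L G c \<in> relu_functions n"
proof -
  have "(\<lambda>s. 1 * c p + (- L) * (\<Sum>i<n. \<bar>vec_index s i - vec_index p i\<bar>)) \<in> relu_functions n" for p
    by (intro relu_functions_lincomb relu_functions_const relu_functions_sum
        relu_functions_abs_coord) auto
  from relu_functions_Max[OF assms this] show ?thesis
    by (simp add: mcshane_def[abs_def])
qed

lemma finite_net_of_interval: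
  fixes a b :: real
  assumes "h > 0"
  shows "\<exists>Q. finite Q \<and> Q \<subseteq> {a..b} \<and> (\<forall>x\<in>{a..b}. \<exists>q\<in>Q. \<bar>x - q\<bar> \<le> h)"
proof -
  have "{a..b} \<subseteq> (\<Union>x\<in>{a..b}. ball x h)" using assms by auto
  then obtain Q where Q: "Q \<subseteq> {a..b}" "finite Q" "{a..b} \<subseteq> (\<Union>x\<in>Q. ball x h)"
    using compactE_image[OF compact_Icc[of a b], of "{a..b}" "\<lambda>x. ball x h"] by auto
  have "\<exists>q\<in>Q. \<bar>x - q\<bar> \<le> h" if x: "x \<in> {a..b}" for x
  proof -
    obtain q where "q \<in> Q" "x \<in> ball q h" using Q(3) x by blast
    then show ?thesis by (intro bexI[of _ q]) (auto simp: dist_real_def abs_minus_commute)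
  qed
  with Q show ?thesis by blast
qed

definition cube :: "nat \<Rightarrow> real \<Rightarrow> real vec set" where
  "cube n M = {s \<in> carrier_vec n. \<forall>i<n. vec_index s i \<in> {-M..M}}"

text \<open>
  The depth \<open>t\<close> and size \<open>r\<close> come before \<open>f\<close>: this uniformity lets the network follow the data
  while these bounds stay fixed. It results from rounding the values of \<open>f\<close> on the grid \<open>G\<close> to
  the finite set \<open>V\<close>, since then one of finitely many envelopes is used.
\<close>
theorem relu_nets_approximate_lipschitz:
  assumes "\<delta> > 0" "M > 0" "L \<ge> 0"
  shows "\<exists>t r. \<forall>f.
    (\<forall>s\<in>cube n M. \<forall>s'\<in>cube n M. \<bar>f s - f s'\<bar> \<le> L * (\<Sum>i<n. \<bar>vec_index s i - vec_index s' i\<bar>)) \<longrightarrow>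
    (\<forall>s\<in>cube n M. \<bar>f s\<bar> \<le> B) \<longrightarrow>
    (\<exists>t'\<le>t. \<exists>r'\<le>r. \<exists>g\<in>nets n t' r'. \<forall>s\<in>cube n M. \<bar>g s - f s\<bar> \<le> \<delta>)"
proof -
  \<comment> \<open>Mesh of the grid. Rounding the values costs \<open>\<delta> / 2\<close> and moving to the nearest grid point costs
      twice \<open>L * n * h\<close>; the summand 1 keeps the denominator positive when \<open>L\<close> or \<open>n\<close> is 0.\<close>
  define h where "h = \<delta> / (4 * (L * n + 1))"
  have h: "h > 0" "2 * (L * (n * h)) \<le> \<delta> / 2"
  proof -
    have pos: "L * n + 1 > 0" using assms(3) by (simp add: add_nonneg_pos)
    then show "h > 0" using assms(1) by (simp add: h_def)
    have "L * n \<le> L * n + 1" by simp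
    then have "2 * (L * n) * h \<le> 2 * (L * n + 1) * h" using \<open>h > 0\<close> by (intro mult_right_mono) auto
    also have "\<dots> = \<delta> / 2" using pos by (simp add: h_def field_simps)
    finally show "2 * (L * (n * h)) \<le> \<delta> / 2" by (simp add: mult.assoc)
  qed
  obtain Q where Q: "finite Q" "Q \<subseteq> {-M..M}" "\<forall>x\<in>{-M..M}. \<exists>q\<in>Q. \<bar>x - q\<bar> \<le> h"
    using finite_net_of_interval[OF h(1), of "-M" M] by auto
  obtain V where V: "finite V" "\<forall>x\<in>{-B..B}. \<exists>v\<in>V. \<bar>x - v\<bar> \<le> \<delta> / 2"
    using finite_net_of_interval[OF half_gt_zero[OF assms(1)], of "-B" B] by blast
  define G where "G = (\<lambda>a. Matrix.vec n a) ` PiE {..<n} (\<lambda>_. Q)"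
  have near: "\<exists>p\<in>G. \<forall>i<n. \<bar>vec_index s i - vec_index p i\<bar> \<le> h" if s: "s \<in> cube n M" for s
  proof -
    have "\<forall>i\<in>{..<n}. \<exists>q\<in>Q. \<bar>vec_index s i - q\<bar> \<le> h"
    proof
      fix i assume "i \<in> {..<n}"
      then have "vec_index s i \<in> {-M..M}" using s by (simp add: cube_def)
      then show "\<exists>q\<in>Q. \<bar>vec_index s i - q\<bar> \<le> h" using Q(3) by blast
    qed
    then obtain a where a: "\<forall>i\<in>{..<n}. a i \<in> Q \<and> \<bar>vec_index s i - a i\<bar> \<le> h" by metis
    show ?thesis
      by (rule bexI[of _ "Matrix.vec n (restrict a {..<n})"]) (use a in \<open>auto simp: G_def\<close>)
  qed
  have G: "finite G" "G \<subseteq> cube n M"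
    using Q by (auto simp: G_def cube_def finite_PiE PiE_iff subset_iff)
  have "Matrix.vec n (\<lambda>_. 0) \<in> cube n M" using assms(2) by (auto simp: cube_def)
  with near have "G \<noteq> {}" by blast
  define C where "C = PiE G (\<lambda>_. V)"
  have "finite C" unfolding C_def using G V by (intro finite_PiE) auto
  have "\<exists>t r. mcshane n L G c \<in> nets n t r" for c
    by (rule relu_functions_in_nets[OF mcshane_relu[OF G(1) \<open>G \<noteq> {}\<close>]])
  then obtain t r where tr: "\<And>c. mcshane n L G c \<in> nets n (t c) (r c)" by metis
  show ?thesis
  proof (rule exI[of _ "Max (t ` C)"], rule exI[of _ "Max (r ` C)"], intro allI impI)
    fix f
    assume lip: "\<forall>s\<in>cube n M. \<forall>s'\<in>cube n M.
        \<bar>f s - f s'\<bar> \<le> L * (\<Sum>i<n. \<bar>vec_index s i - vec_index s' i\<bar>)"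
      and bd: "\<forall>s\<in>cube n M. \<bar>f s\<bar> \<le> B"
    have "\<forall>p\<in>G. \<exists>v\<in>V. \<bar>f p - v\<bar> \<le> \<delta> / 2"
    proof
      fix p assume "p \<in> G"
      then have "\<bar>f p\<bar> \<le> B" using G(2) bd by blast
      then have "f p \<in> {-B..B}" by (simp add: abs_le_iff)
      then show "\<exists>v\<in>V. \<bar>f p - v\<bar> \<le> \<delta> / 2" using V(2) by blast
    qed
    then obtain c where c: "\<And>p. p \<in> G \<Longrightarrow> c p \<in> V" "\<And>p. p \<in> G \<Longrightarrow> \<bar>f p - c p\<bar> \<le> \<delta> / 2" by metis
    define c' where "c' = restrict c G"
    have "c' \<in> C" using c(1) by (auto simp: C_def c'_def)
    have "\<bar>mcshane n L G c' s - f s\<bar> \<le> \<delta>" if s: "s \<in> cube n M" for s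
    proof -
      let ?l = "\<lambda>p. \<Sum>i<n. \<bar>vec_index s i - vec_index p i\<bar>"
      have "mcshane n L G c' s \<le> f s + \<delta> / 2"
        unfolding mcshane_def
      proof (rule Max.boundedI)
        fix a assume "a \<in> (\<lambda>p. c' p - L * ?l p) ` G"
        then obtain p where p: "p \<in> G" "a = c p - L * ?l p" by (auto simp: c'_def)
        have "p \<in> cube n M" using p G by auto
        then have "\<bar>f s - f p\<bar> \<le> L * ?l p" using lip s by blast
        with c(2)[OF p(1)] p(2) show "a \<le> f s + \<delta> / 2" by linarith
      qed (use G \<open>G \<noteq> {}\<close> in auto)
      moreover have "f s - \<delta> \<le> mcshane n L G c' s"
      proof -
        obtain p where p: "p \<in> G" "\<forall>i<n. \<bar>vec_index s i - vec_index p i\<bar> \<le> h"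
          using near[OF s] by blast
        have "?l p \<le> (\<Sum>i<n. h)" using p(2) by (intro sum_mono) auto
        then have "L * ?l p \<le> L * (n * h)" using assms(3) by (intro mult_left_mono) auto
        moreover have "p \<in> cube n M" using p G by auto
        then have "\<bar>f s - f p\<bar> \<le> L * ?l p" using lip s by blast
        moreover have "c' p - L * ?l p \<le> mcshane n L G c' s"
          unfolding mcshane_def using G p by (intro Max_ge) auto
        moreover have c'p: "c' p = c p" using p(1) by (simp add: c'_def)
        ultimately show ?thesis using c(2)[OF p(1)] h(2) c'p by linarith
      qed
      ultimately show ?thesis using assms(1) by (simp add: abs_le_iff)
    qed
    then show "\<exists>t'\<le>Max (t ` C). \<exists>r'\<le>Max (r ` C). \<exists>g\<in>nets n t' r'. \<forall>s\<in>cube n M. \<bar>g s - f s\<bar> \<le> \<delta>"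
      using tr \<open>c' \<in> C\<close> \<open>finite C\<close>
      by (intro exI[of _ "t c'"] exI[of _ "r c'"] conjI bexI[of _ "mcshane n L G c'"]) auto
  qed
qed

section \<open>Projections, completeness and optimality of PCA\<close>

text \<open>
  Zero vectors are admitted so that the padded eigenvectors of \<open>pca_eigensystem\<close> and the
  output of the Gram-Schmidt process on a linearly dependent sequence are both covered. The
  partial sums \<open>proj\<close> are still orthogonal projections, since zero vectors contribute nothing.
\<close>
definition orthonormal_or_zero :: "nat \<Rightarrow> (nat \<Rightarrow> 'a::real_inner) \<Rightarrow> bool" where
  "orthonormal_or_zero n e \<longleftrightarrow> (\<forall>i<n. \<forall>j<n. i \<noteq> j \<longrightarrow> inner (e i) (e j) = 0) \<and>
     (\<forall>i<n. e i = 0 \<or> inner (e i) (e i) = 1)"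

definition proj :: "nat \<Rightarrow> (nat \<Rightarrow> 'a::real_inner) \<Rightarrow> 'a \<Rightarrow> 'a" where
  "proj n e x = (\<Sum>i<n. inner (e i) x *\<^sub>R e i)"

lemma orthonormal_or_zero_mono: "orthonormal_or_zero n e \<Longrightarrow> m \<le> n \<Longrightarrow> orthonormal_or_zero m e"
  by (auto simp: orthonormal_or_zero_def)

lemma orthonormal_or_zero_inner:
  assumes "orthonormal_or_zero n e" "i < n" "j < n"
  shows "inner (e i) (e j) = (if i = j \<and> e i \<noteq> 0 then 1 else 0)"
  using assms by (auto simp: orthonormal_or_zero_def)

lemma orthonormal_or_zero_norm:
  assumes "orthonormal_or_zero n e" "i < n"
  shows "norm (e i) \<le> 1"
  using assms orthonormal_or_zero_inner[of n e i i] by (auto simp: norm_eq_sqrt_inner)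

lemma linear_proj: "linear (proj n e)"
  by (rule linearI)
     (auto simp: proj_def inner_add_right algebra_simps sum.distrib scaleR_sum_right)

lemma proj_diff: "proj n e (x - y) = proj n e x - proj n e y"
  by (simp add: linear_diff linear_proj)

lemma norm_sum_orthogonal:
  assumes "orthonormal_or_zero n e"
  shows "norm (\<Sum>i<n. c i *\<^sub>R e i) \<le> (\<Sum>i<n. \<bar>c i\<bar>)"
proof -
  have "norm (c i *\<^sub>R e i) \<le> \<bar>c i\<bar>" if "i < n" for i
    using mult_left_mono[OF orthonormal_or_zero_norm[OF assms that], of "\<bar>c i\<bar>"] by simp
  then show ?thesis by (intro sum_norm_le) auto
qed

lemma inner_proj:
  assumes "orthonormal_or_zero n e" "j < n"
  shows "inner (e j) (proj n e x) = inner (e j) x"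
proof -
  have "inner (e j) (proj n e x) = (\<Sum>i<n. inner (e i) x * inner (e j) (e i))"
    by (simp add: proj_def inner_sum_right)
  also have "\<dots> = (\<Sum>i<n. if i = j then inner (e j) x else 0)"
    using assms orthonormal_or_zero_inner[OF assms(1)] by (intro sum.cong) auto
  finally show ?thesis using assms(2) by simp
qed

lemma proj_basis:
  assumes "orthonormal_or_zero n e" "j < n"
  shows "proj n e (e j) = e j"
proof -
  have "proj n e (e j) = (\<Sum>i<n. if i = j then e j else 0)"
    unfolding proj_def using assms orthonormal_or_zero_inner[OF assms(1)]
    by (intro sum.cong) auto
  then show ?thesis using assms(2) by simp
qed

lemma inner_proj_self:
  "inner x (proj n e x) = (\<Sum>i<n. (inner (e i) x)\<^sup>2)"
  by (simp add: proj_def inner_sum_right power2_eq_square inner_commute)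

lemma inner_proj_proj:
  assumes "orthonormal_or_zero n e"
  shows "inner (proj n e x) (proj n e x) = (\<Sum>i<n. (inner (e i) x)\<^sup>2)"
proof -
  have "inner (proj n e x) (proj n e x) = (\<Sum>i<n. inner (e i) x * inner (e i) (proj n e x))"
    by (subst (1) proj_def) (simp add: inner_sum_left)
  then show ?thesis using inner_proj[OF assms] by (simp add: power2_eq_square)
qed

lemma norm_residual:
  assumes "orthonormal_or_zero n e"
  shows "(norm (x - proj n e x))\<^sup>2 = (norm x)\<^sup>2 - (\<Sum>i<n. (inner (e i) x)\<^sup>2)"
  using inner_proj_self[of x n e] inner_proj_proj[OF assms, of x]
  by (simp add: power2_norm_eq_inner inner_diff_left inner_diff_right inner_commute)

lemma bessel:
  assumes "orthonormal_or_zero n e"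
  shows "(\<Sum>i<n. (inner (e i) x)\<^sup>2) \<le> (norm x)\<^sup>2"
  using norm_residual[OF assms, of x] by (smt (verit) zero_le_power2)

lemma norm_proj_le:
  assumes "orthonormal_or_zero n e"
  shows "norm (proj n e x) \<le> norm x"
  using inner_proj_proj[OF assms, of x] bessel[OF assms, of x]
  by (simp add: norm_eq_sqrt_inner power2_norm_eq_inner)

lemma norm_residual_le:
  assumes "orthonormal_or_zero n e"
  shows "norm (x - proj n e x) \<le> norm x"
proof (rule power2_le_imp_le)
  show "(norm (x - proj n e x))\<^sup>2 \<le> (norm x)\<^sup>2"
    using norm_residual[OF assms, of x] sum_nonneg[of "{..<n}" "\<lambda>i. (inner (e i) x)\<^sup>2"] by simp
qed simp

text \<open>
  As \<open>sgn 0 = 0\<close>, a vector that depends on its predecessors yields 0.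
\<close>
fun gram_schmidt :: "(nat \<Rightarrow> 'a::real_inner) \<Rightarrow> nat \<Rightarrow> 'a" where
  "gram_schmidt d k = sgn (d k - (\<Sum>i<k. inner (gram_schmidt d i) (d k) *\<^sub>R gram_schmidt d i))"

declare gram_schmidt.simps [simp del]

lemma gram_schmidt_proj: "gram_schmidt d k = sgn (d k - proj k (gram_schmidt d) (d k))"
  unfolding proj_def by (rule gram_schmidt.simps)

lemma gram_schmidt_orthonormal: "orthonormal_or_zero n (gram_schmidt d)"
proof (induction n)
  case (Suc n)
  let ?e = "gram_schmidt d" and ?r = "d n - proj n (gram_schmidt d) (d n)"
  have "inner (?e i) (?e n) = 0" if "i < n" for i
    using inner_proj[OF Suc that, of "d n"]
    by (simp add: gram_schmidt_proj[of d n] sgn_div_norm inner_diff_right)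
  moreover have "?e n = 0 \<or> inner (?e n) (?e n) = 1"
    using norm_sgn[of ?r] by (simp add: gram_schmidt_proj[of d n] norm_eq_sqrt_inner split: if_splits)
  ultimately show ?case
    using Suc unfolding orthonormal_or_zero_def by (auto simp: less_Suc_eq inner_commute)
qed (simp add: orthonormal_or_zero_def)

lemma proj_gram_schmidt:
  assumes "k < n"
  shows "proj n (gram_schmidt d) (d k) = d k"
proof -
  let ?e = "gram_schmidt d" and ?r = "d k - proj k (gram_schmidt d) (d k)"
  have "?r = norm ?r *\<^sub>R ?e k"
    unfolding gram_schmidt_proj[of d k] sgn_div_norm by (cases "?r = 0") simp_all
  then have eq: "d k = (\<Sum>i<k. inner (?e i) (d k) *\<^sub>R ?e i) + norm ?r *\<^sub>R ?e k"
    by (metis diff_add_cancel add.commute proj_def)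
  have "proj n ?e ((\<Sum>i<k. inner (?e i) (d k) *\<^sub>R ?e i) + norm ?r *\<^sub>R ?e k) =
      (\<Sum>i<k. inner (?e i) (d k) *\<^sub>R proj n ?e (?e i)) + norm ?r *\<^sub>R proj n ?e (?e k)"
    by (simp only: linear_add[OF linear_proj] linear_sum[OF linear_proj] linear_scale[OF linear_proj])
  also have "\<dots> = (\<Sum>i<k. inner (?e i) (d k) *\<^sub>R ?e i) + norm ?r *\<^sub>R ?e k"
    using assms proj_basis[OF gram_schmidt_orthonormal[of n d]] by simp
  finally show ?thesis using eq by simp
qed

text \<open>
  Apply Gram-Schmidt to a countable dense sequence. The projections fix more and more of its
  members, and a projection that fixes \<open>y\<close> moves \<open>x\<close> by at most \<open>norm (x - y)\<close>.
\<close>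
lemma complete_orthonormal_sequence:
  obtains e :: "nat \<Rightarrow> 'a::{real_inner, second_countable_topology}"
  where "\<And>n. orthonormal_or_zero n e" "\<And>x. (\<lambda>n. proj n e x) \<longlonglongrightarrow> x"
proof -
  obtain D :: "'a set" where D: "countable D" "\<And>X. open X \<Longrightarrow> X \<noteq> {} \<Longrightarrow> \<exists>d\<in>D. d \<in> X"
    by (rule countable_dense_setE) blast
  have "D \<noteq> {}" using D(2)[of UNIV] by auto
  define d where "d = from_nat_into D"
  let ?e = "gram_schmidt d"
  have "(\<lambda>n. proj n ?e x) \<longlonglongrightarrow> x" for x
  proof (rule LIMSEQ_I)
    fix r :: real assume "0 < r"
    then obtain y where y: "y \<in> D" "y \<in> ball x r" using D(2)[of "ball x r"] by auto
    then obtain k where k: "y = d k"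
      using from_nat_into_surj[OF D(1)] by (auto simp: d_def)
    have "norm (proj n ?e x - x) < r" if "Suc k \<le> n" for n
    proof -
      have "proj n ?e (d k) = d k" using that by (intro proj_gram_schmidt) simp
      then have "x - proj n ?e x = (x - y) - proj n ?e (x - y)"
        by (simp add: proj_diff k)
      then have "norm (x - proj n ?e x) \<le> norm (x - y)"
        by (metis norm_residual_le[OF gram_schmidt_orthonormal])
      also have "\<dots> < r" using y by (simp add: dist_norm)
      finally show ?thesis by (simp add: norm_minus_commute)
    qed
    then show "\<exists>no. \<forall>n\<ge>no. norm (proj n ?e x - x) < r" by blast
  qed
  with gram_schmidt_orthonormal that show ?thesis by blast
qed

lemma pca_basis_orthonormal:
  assumes "is_pca_basis N u phi"
  shows "orthonormal_or_zero N phi"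
proof -
  obtain lam where lam: "pca_eigensystem N u lam phi"
    using assms by (auto simp: is_pca_basis_def)
  obtain m where m: "m \<le> N"
    "\<forall>i<m. \<forall>j<m. inner (phi i) (phi j) = (if i = j then 1 else 0)"
    "\<forall>j. m \<le> j \<and> j < N \<longrightarrow> phi j = 0 \<and> lam j = 0"
    using lam unfolding pca_eigensystem_def by auto
  have split: "i < m \<or> phi i = 0" if "i < N" for i
    using m(3) that by (cases "i < m") auto
  show ?thesis
    unfolding orthonormal_or_zero_def
  proof (intro conjI allI impI)
    fix i j assume "i < N" "j < N" "i \<noteq> j"
    then show "inner (phi i) (phi j) = 0"
      using m(2) split[of i] split[of j] by (cases "phi i = 0 \<or> phi j = 0") auto
  next
    fix i assume "i < N"
    then show "phi i = 0 \<or> inner (phi i) (phi i) = 1" using m(2) split[of i] by auto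
  qed
qed

text \<open>
  The linear programme behind Ky Fan's inequality: weights between 0 and 1 of total mass at
  most \<open>d\<close> do best on the \<open>d\<close> largest values. Subtracting \<open>lam d\<close> makes all terms from index
  \<open>d\<close> on nonpositive.
\<close>
lemma weighted_sum_le_leading_sum:
  fixes lam a :: "nat \<Rightarrow> real"
  assumes "\<And>i j. i \<le> j \<Longrightarrow> j < N \<Longrightarrow> lam j \<le> lam i" "\<And>i. i < N \<Longrightarrow> 0 \<le> lam i"
    and "\<And>i. i < N \<Longrightarrow> 0 \<le> a i" "\<And>i. i < N \<Longrightarrow> a i \<le> 1" "(\<Sum>i<N. a i) \<le> real d" "d \<le> N"
  shows "(\<Sum>i<N. lam i * a i) \<le> (\<Sum>i<d. lam i)"
proof (cases "d = N")
  case True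
  have "lam i * a i \<le> lam i" if "i < N" for i
    using mult_left_mono[OF assms(4)[OF that] assms(2)[OF that]] by simp
  then show ?thesis unfolding True by (intro sum_mono) auto
next
  case False
  then have d: "d < N" using assms(6) by simp
  let ?c = "lam d"
  have "(\<Sum>i<N. lam i * a i) = (\<Sum>i<N. (lam i - ?c) * a i) + ?c * (\<Sum>i<N. a i)"
    by (simp add: algebra_simps sum.distrib sum_distrib_left sum_subtractf)
  also have "(\<Sum>i<N. (lam i - ?c) * a i) \<le> (\<Sum>i<N. if i < d then lam i - ?c else 0)"
  proof (intro sum_mono)
    fix i assume "i \<in> {..<N}"
    then have i: "i < N" by simp
    show "(lam i - ?c) * a i \<le> (if i < d then lam i - ?c else 0)"
    proof (cases "i < d")
      case True
      then have "0 \<le> lam i - ?c" using assms(1)[of i d] d by simp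
      from mult_left_mono[OF assms(4)[OF i] this] True show ?thesis by simp
    next
      case False
      then have "lam i \<le> ?c" using assms(1)[of d i] i by simp
      with assms(3)[OF i] False show ?thesis by (simp add: mult_nonpos_nonneg)
    qed
  qed
  also have "(\<Sum>i<N. if i < d then lam i - ?c else 0) = (\<Sum>i<d. lam i - ?c)"
    using d by (intro sum.mono_neutral_cong_right) auto
  also have "\<dots> = (\<Sum>i<d. lam i) - real d * ?c" by (simp add: sum_subtractf)
  also have "?c * (\<Sum>i<N. a i) \<le> ?c * real d"
    using assms(2)[OF d] assms(5) by (rule mult_left_mono[rotated])
  finally show ?thesis by simp
qed

lemma inner_emp_cov:
  assumes "N > 0"
  shows "(\<Sum>j<N. (inner v (u j))\<^sup>2) = real N * inner v (emp_cov N u v)"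
  using assms by (simp add: emp_cov_def inner_sum_right power2_eq_square inner_commute)

lemma emp_cov_diff: "emp_cov N u (v - w) = emp_cov N u v - emp_cov N u w"
  by (simp add: emp_cov_def inner_diff_right scaleR_left_diff_distrib sum_subtractf
      scaleR_right_diff_distrib)

lemma emp_cov_sum: "emp_cov N u (\<Sum>i\<in>A. c i *\<^sub>R v i) = (\<Sum>i\<in>A. c i *\<^sub>R emp_cov N u (v i))"
proof -
  have lin: "linear (emp_cov N u)"
    by (rule linearI)
       (auto simp: emp_cov_def inner_add_right algebra_simps sum.distrib scaleR_sum_right)
  show ?thesis by (simp add: linear_sum[OF lin] linear_scale[OF lin])
qed

text \<open>
  By Pythagoras, a small residual means a large captured energy \<open>\<Sum>\<^sub>l \<langle>e\<^sub>l, C e\<^sub>l\<rangle>\<close>, where \<open>C\<close>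
  is the empirical covariance. Expanding \<open>C\<close> in its eigenvectors turns this into a sum of the
  eigenvalues with weights \<open>\<Sum>\<^sub>l \<langle>e\<^sub>l, \<phi>\<^sub>i\<rangle>\<^sup>2\<close>, and Bessel's inequality, used for either
  system, shows that these weights are as in \<open>weighted_sum_le_leading_sum\<close>.
\<close>
lemma pca_minimises_reconstruction_error:
  assumes "is_pca_basis N u phi" "d \<le> N" "orthonormal_or_zero d e"
  shows "(\<Sum>j<N. (norm (u j - proj d phi (u j)))\<^sup>2) \<le> (\<Sum>j<N. (norm (u j - proj d e (u j)))\<^sup>2)"
proof (cases "N = 0")
  case False
  then have N: "N > 0" by simp
  obtain lam where lam: "pca_eigensystem N u lam phi"
    using assms(1) by (auto simp: is_pca_basis_def)
  have phi: "orthonormal_or_zero N phi" using assms(1) by (rule pca_basis_orthonormal)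
  have phid: "orthonormal_or_zero d phi" using phi assms(2) by (rule orthonormal_or_zero_mono)
  have eig: "emp_cov N u (phi i) = lam i *\<^sub>R phi i" if "i < N" for i
    using lam that by (simp add: pca_eigensystem_def)
  have zero: "phi i = 0 \<Longrightarrow> lam i = 0" if "i < N" for i
  proof -
    assume z: "phi i = 0"
    obtain m where m: "m \<le> N" "\<forall>i<m. \<forall>j<m. inner (phi i) (phi j) = (if i = j then 1 else 0)"
      "\<forall>j. m \<le> j \<and> j < N \<longrightarrow> phi j = 0 \<and> lam j = 0"
      using lam unfolding pca_eigensystem_def by auto
    have "\<not> i < m" using m(2) z by (metis inner_zero_left zero_neq_one)
    with m(3) that show "lam i = 0" by simp
  qed
  \<comment> \<open>\<open>v - proj N phi v\<close> is orthogonal to all \<open>phi j\<close>, hence in the kernel of the covariance.\<close>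
  have spec: "emp_cov N u v = (\<Sum>i<N. inner (phi i) v *\<^sub>R lam i *\<^sub>R phi i)" for v
  proof -
    have "\<forall>j<N. inner (phi j) (v - proj N phi v) = 0"
      using inner_proj[OF phi] by (simp add: inner_diff_right)
    then have "emp_cov N u (v - proj N phi v) = 0" using lam by (simp add: pca_eigensystem_def)
    then have "emp_cov N u v = emp_cov N u (proj N phi v)" by (simp add: emp_cov_diff)
    also have "\<dots> = (\<Sum>i<N. inner (phi i) v *\<^sub>R lam i *\<^sub>R phi i)"
      unfolding proj_def emp_cov_sum using eig by simp
    finally show ?thesis .
  qed
  have energy: "(\<Sum>j<N. \<Sum>l<d. (inner (w l) (u j))\<^sup>2) =
      real N * (\<Sum>l<d. inner (w l) (emp_cov N u (w l)))" for w
    by (subst sum.swap) (simp add: inner_emp_cov[OF N] sum_distrib_left)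
  define a where "a i = (\<Sum>l<d. (inner (e l) (phi i))\<^sup>2)" for i
  have "(\<Sum>l<d. inner (e l) (emp_cov N u (e l))) = (\<Sum>i<N. lam i * a i)"
    unfolding spec a_def
    by (simp add: inner_sum_right sum_distrib_left power2_eq_square inner_commute)
       (subst sum.swap, simp add: mult_ac)
  also have "\<dots> \<le> (\<Sum>i<d. lam i)"
  proof (rule weighted_sum_le_leading_sum)
    show "lam j \<le> lam i" if "i \<le> j" "j < N" for i j
      using lam that unfolding pca_eigensystem_def by blast
    show "0 \<le> lam i" if "i < N" for i using lam that unfolding pca_eigensystem_def by blast
    show "0 \<le> a i" for i unfolding a_def by (intro sum_nonneg) auto
    show "a i \<le> 1" if "i < N" for i
    proof -
      have "a i \<le> (norm (phi i))\<^sup>2" unfolding a_def by (rule bessel[OF assms(3)])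
      also have "\<dots> \<le> 1" using orthonormal_or_zero_norm[OF phi that] by (simp add: power_le_one)
      finally show ?thesis .
    qed
    have "(\<Sum>i<N. a i) = (\<Sum>l<d. \<Sum>i<N. (inner (phi i) (e l))\<^sup>2)"
      unfolding a_def by (subst sum.swap) (simp add: inner_commute)
    also have "\<dots> \<le> (\<Sum>l<d. 1)"
    proof (intro sum_mono)
      fix l assume "l \<in> {..<d}"
      then have "norm (e l) \<le> 1" using orthonormal_or_zero_norm[OF assms(3)] by simp
      then have "(norm (e l))\<^sup>2 \<le> 1" by (simp add: power_le_one)
      with bessel[OF phi, of "e l"] show "(\<Sum>i<N. (inner (phi i) (e l))\<^sup>2) \<le> 1" by linarith
    qed
    finally show "(\<Sum>i<N. a i) \<le> real d" by simp
  qed (fact assms(2))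
  also have "\<dots> = (\<Sum>l<d. inner (phi l) (emp_cov N u (phi l)))"
  proof (rule sum.cong)
    fix l assume "l \<in> {..<d}"
    then have l: "l < N" using assms(2) by simp
    show "lam l = inner (phi l) (emp_cov N u (phi l))"
      using eig[OF l] zero[OF l] orthonormal_or_zero_inner[OF phi l l] by simp
  qed simp
  finally have "(\<Sum>j<N. \<Sum>l<d. (inner (e l) (u j))\<^sup>2) \<le> (\<Sum>j<N. \<Sum>l<d. (inner (phi l) (u j))\<^sup>2)"
    unfolding energy by (simp add: mult_left_mono)
  then show ?thesis
    by (simp add: norm_residual[OF phid] norm_residual[OF assms(3)] sum_subtractf)
qed simp

section \<open>Averages of independent samples\<close>

lemma (in prob_space) PiM_component_integral:
  fixes w :: "'a \<Rightarrow> real" and N :: nat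
  assumes "integrable M w" "j < N"
  shows "integrable (PiM {..<N} (\<lambda>_. M)) (\<lambda>xs. w (xs j))"
    and "(\<integral>xs. w (xs j) \<partial>PiM {..<N} (\<lambda>_. M)) = (\<integral>x. w x \<partial>M)"
proof -
  let ?D = "PiM {..<N} (\<lambda>_. M)"
  have d: "distr ?D M (\<lambda>xs. xs j) = M"
    using assms(2) by (intro distr_PiM_component) (auto intro: prob_space_axioms)
  have m: "(\<lambda>xs. xs j) \<in> measurable ?D M" using assms(2) by simp
  show "integrable ?D (\<lambda>xs. w (xs j))"
    using integrable_distr[OF m, of w] assms(1) by (simp add: d)
  show "(\<integral>xs. w (xs j) \<partial>?D) = (\<integral>x. w x \<partial>M)"
    using integral_distr[OF m, of w] assms(1) by (simp add: d borel_measurable_integrable)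
qed

lemma (in prob_space) PiM_average_integral:
  fixes w :: "'a \<Rightarrow> real" and N :: nat
  assumes "integrable M w" "N > 0"
  shows "integrable (PiM {..<N} (\<lambda>_. M)) (\<lambda>xs. (\<Sum>j<N. w (xs j)) / real N)"
    and "(\<integral>xs. (\<Sum>j<N. w (xs j)) / real N \<partial>PiM {..<N} (\<lambda>_. M)) = (\<integral>x. w x \<partial>M)"
  using assms PiM_component_integral[OF assms(1), of _ N]
  by (auto intro!: integrable_divide_zero Bochner_Integration.integrable_sum)

lemma (in prob_space) PiM_two_components_integral:
  fixes w :: "'a \<Rightarrow> real" and N :: nat
  assumes "integrable M w" "j < N" "k < N" "j \<noteq> k"
  shows "integrable (PiM {..<N} (\<lambda>_. M)) (\<lambda>xs. w (xs j) * w (xs k))"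
    and "(\<integral>xs. w (xs j) * w (xs k) \<partial>PiM {..<N} (\<lambda>_. M)) = (\<integral>x. w x \<partial>M)\<^sup>2"
proof -
  interpret P: product_sigma_finite "\<lambda>_::nat. M"
    by (intro product_sigma_finite.intro) (simp add: sigma_finite_measure_axioms)
  define f where "f i = (if i \<in> {j, k} then w else (\<lambda>_. 1))" for i
  have int: "integrable M (f i)" for i using assms(1) by (simp add: f_def)
  have two: "(\<Prod>i<N. if i \<in> {j, k} then v i else 1) = v j * v k" for v :: "nat \<Rightarrow> real"
  proof -
    have "(\<Prod>i<N. if i \<in> {j, k} then v i else 1) = (\<Prod>i\<in>{j, k}. v i)"
      using assms by (intro prod.mono_neutral_cong_right) auto
    then show ?thesis using assms(4) by simp
  qed
  have eq: "(\<Prod>i<N. f i (xs i)) = w (xs j) * w (xs k)" for xs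
    using two[of "\<lambda>i. w (xs i)"] by (simp add: f_def if_distribR cong: if_cong)
  show "integrable (PiM {..<N} (\<lambda>_. M)) (\<lambda>xs. w (xs j) * w (xs k))"
    using P.product_integrable_prod[of "{..<N}" f] int by (simp add: eq)
  have "(\<Prod>i<N. integral\<^sup>L M (f i)) = (\<Prod>i<N. if i \<in> {j, k} then integral\<^sup>L M w else 1)"
    by (intro prod.cong) (auto simp: f_def prob_space)
  then show "(\<integral>xs. w (xs j) * w (xs k) \<partial>PiM {..<N} (\<lambda>_. M)) = (\<integral>x. w x \<partial>M)\<^sup>2"
    using P.product_integral_prod[of "{..<N}" f] int two[of "\<lambda>_. integral\<^sup>L M w"]
    by (simp add: eq power2_eq_square)
qed

text \<open>
  The mean is at most the root mean square, and the variance of a sum of independent variables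
  is the sum of their variances.
\<close>
lemma (in prob_space) mean_deviation_of_average:
  fixes w :: "'a \<Rightarrow> real" and N :: nat
  assumes "integrable M w" "integrable M (\<lambda>x. (w x)\<^sup>2)" "N > 0"
  defines "D \<equiv> PiM {..<N} (\<lambda>_. M)"
  shows "integrable D (\<lambda>xs. \<bar>(\<integral>x. w x \<partial>M) - (\<Sum>j<N. w (xs j)) / real N\<bar>)"
    and "(\<integral>xs. \<bar>(\<integral>x. w x \<partial>M) - (\<Sum>j<N. w (xs j)) / real N\<bar> \<partial>D)
         \<le> sqrt ((\<integral>x. (w x)\<^sup>2 \<partial>M) / real N)"
proof -
  interpret D: prob_space D
    unfolding D_def by (intro prob_space_PiM) (rule prob_space_axioms)
  define v where "v x = w x - (\<integral>x. w x \<partial>M)" for x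
  have v2: "(v x)\<^sup>2 = (w x)\<^sup>2 - 2 * (\<integral>x. w x \<partial>M) * w x + (\<integral>x. w x \<partial>M)\<^sup>2" for x
    by (simp add: v_def power2_eq_square algebra_simps)
  have v: "integrable M v" "(\<integral>x. v x \<partial>M) = 0" and iv2: "integrable M (\<lambda>x. (v x)\<^sup>2)"
    unfolding v2 unfolding v_def using assms(1,2) by (simp_all add: prob_space)
  have "(\<integral>x. (v x)\<^sup>2 \<partial>M) = (\<integral>x. (w x)\<^sup>2 \<partial>M) - (\<integral>x. w x \<partial>M)\<^sup>2"
    unfolding v_def using assms(1,2) by (rule variance_eq)
  then have var_le: "(\<integral>x. (v x)\<^sup>2 \<partial>M) \<le> (\<integral>x. (w x)\<^sup>2 \<partial>M)" by simp
  define S where "S xs = (\<Sum>j<N. v (xs j))" for xs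
  have S: "(\<integral>x. w x \<partial>M) - (\<Sum>j<N. w (xs j)) / real N = - (S xs / real N)" for xs
    using assms(3) by (simp add: S_def v_def sum_subtractf field_simps)
  have iS: "integrable D S"
    unfolding S_def D_def using PiM_component_integral(1)[OF v(1), of _ N]
    by (intro Bochner_Integration.integrable_sum) auto
  have prodint: "integrable D (\<lambda>xs. v (xs j) * v (xs k))"
    "(\<integral>xs. v (xs j) * v (xs k) \<partial>D) = (if j = k then \<integral>x. (v x)\<^sup>2 \<partial>M else 0)"
    if "j < N" "k < N" for j k
    using that PiM_two_components_integral[OF v(1), of j N k] PiM_component_integral[OF iv2, of j N]
    by (auto simp: D_def v(2) power2_eq_square)
  have S2: "(S xs)\<^sup>2 = (\<Sum>j<N. \<Sum>k<N. v (xs j) * v (xs k))" for xs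
    by (simp add: S_def power2_eq_square sum_product)
  have iS2: "integrable D (\<lambda>xs. (S xs)\<^sup>2)"
    unfolding S2 using prodint(1) by (intro Bochner_Integration.integrable_sum) auto
  have row: "integrable D (\<lambda>xs. \<Sum>k<N. v (xs j) * v (xs k))"
    "(\<integral>xs. (\<Sum>k<N. v (xs j) * v (xs k)) \<partial>D) = (\<integral>x. (v x)\<^sup>2 \<partial>M)" if "j < N" for j
  proof -
    show "integrable D (\<lambda>xs. \<Sum>k<N. v (xs j) * v (xs k))"
      using prodint(1) that by (intro Bochner_Integration.integrable_sum) auto
    have "(\<integral>xs. (\<Sum>k<N. v (xs j) * v (xs k)) \<partial>D) = (\<Sum>k<N. \<integral>xs. v (xs j) * v (xs k) \<partial>D)"
      using prodint(1) that by (intro Bochner_Integration.integral_sum) auto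
    also have "\<dots> = (\<Sum>k<N. if j = k then \<integral>x. (v x)\<^sup>2 \<partial>M else 0)"
      using prodint(2) that by (intro sum.cong) auto
    finally show "(\<integral>xs. (\<Sum>k<N. v (xs j) * v (xs k)) \<partial>D) = (\<integral>x. (v x)\<^sup>2 \<partial>M)"
      using that by simp
  qed
  have "(\<integral>xs. (S xs)\<^sup>2 \<partial>D) = (\<Sum>j<N. \<integral>xs. (\<Sum>k<N. v (xs j) * v (xs k)) \<partial>D)"
    unfolding S2 using row(1) by (intro Bochner_Integration.integral_sum) auto
  also have "\<dots> = (\<Sum>j<N. \<integral>x. (v x)\<^sup>2 \<partial>M)"
    using row(2) by (intro sum.cong) auto
  finally have ES2: "(\<integral>xs. (S xs)\<^sup>2 \<partial>D) = real N * (\<integral>x. (v x)\<^sup>2 \<partial>M)" by simp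
  show "integrable D (\<lambda>xs. \<bar>(\<integral>x. w x \<partial>M) - (\<Sum>j<N. w (xs j)) / real N\<bar>)"
    unfolding S using iS by simp
  have absS: "integrable D (\<lambda>xs. \<bar>S xs\<bar>)" using iS by simp
  have "(\<integral>xs. \<bar>S xs\<bar> \<partial>D)\<^sup>2 \<le> (\<integral>xs. (S xs)\<^sup>2 \<partial>D)"
    using D.variance_positive[of "\<lambda>xs. \<bar>S xs\<bar>"] D.variance_eq[OF absS] iS2 by simp
  also have "\<dots> \<le> real N * (\<integral>x. (w x)\<^sup>2 \<partial>M)"
    unfolding ES2 using var_le by (intro mult_left_mono) auto
  finally have "(\<integral>xs. \<bar>S xs\<bar> \<partial>D) \<le> sqrt (real N * (\<integral>x. (w x)\<^sup>2 \<partial>M))"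
    by (rule real_le_rsqrt)
  also have "\<dots> = real N * sqrt ((\<integral>x. (w x)\<^sup>2 \<partial>M) / real N)"
    using assms(3) by (simp add: real_sqrt_divide real_sqrt_mult field_simps)
  finally show "(\<integral>xs. \<bar>(\<integral>x. w x \<partial>M) - (\<Sum>j<N. w (xs j)) / real N\<bar> \<partial>D)
      \<le> sqrt ((\<integral>x. (w x)\<^sup>2 \<partial>M) / real N)"
    unfolding S using assms(3) by (simp add: divide_le_eq mult.commute)
qed

section \<open>Population error of the PCA projection\<close>

text \<open>
  Factor the difference of squares. A residual map is a contraction, so it changes by at most
  \<open>norm (y - proj K e y)\<close>, and both residuals have norm at most \<open>norm y\<close>.
\<close>
lemma residual_perturbation:
  assumes "orthonormal_or_zero d p" "orthonormal_or_zero K e"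
  shows "\<bar>(norm (y - proj d p y))\<^sup>2 - (norm (proj K e y - proj d p (proj K e y)))\<^sup>2\<bar>
    \<le> 2 * norm y * norm (y - proj K e y)"
proof -
  let ?R = "\<lambda>z. z - proj d p z" and ?Q = "proj K e y"
  have "\<bar>norm (?R y) - norm (?R ?Q)\<bar> \<le> norm (?R y - ?R ?Q)" by (rule norm_triangle_ineq3)
  also have "?R y - ?R ?Q = ?R (y - ?Q)" by (simp add: proj_diff)
  also have "norm (?R (y - ?Q)) \<le> norm (y - ?Q)" by (rule norm_residual_le[OF assms(1)])
  finally have 1: "\<bar>norm (?R y) - norm (?R ?Q)\<bar> \<le> norm (y - ?Q)" .
  have "norm (?R y) \<le> norm y" "norm (?R ?Q) \<le> norm y"
    using norm_residual_le[OF assms(1), of y] norm_residual_le[OF assms(1), of ?Q]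
      norm_proj_le[OF assms(2), of y] by auto
  then have 2: "norm (?R y) + norm (?R ?Q) \<le> 2 * norm y" by simp
  have "(norm (?R y))\<^sup>2 - (norm (?R ?Q))\<^sup>2 = (norm (?R y) + norm (?R ?Q)) * (norm (?R y) - norm (?R ?Q))"
    by (simp add: power2_eq_square algebra_simps)
  then have "\<bar>(norm (?R y))\<^sup>2 - (norm (?R ?Q))\<^sup>2\<bar> =
      (norm (?R y) + norm (?R ?Q)) * \<bar>norm (?R y) - norm (?R ?Q)\<bar>"
    by (simp add: abs_mult)
  also have "\<dots> \<le> (2 * norm y) * norm (y - ?Q)"
    using 1 2 by (intro mult_mono) auto
  finally show ?thesis by simp
qed

text \<open>
  With \<open>r a = e a - proj d p (e a)\<close>, the coefficients are \<open>c a b = inner (r a) (r b)\<close>. Their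
  bound does not depend on \<open>d\<close> and \<open>p\<close>, which makes the deviation below uniform over all
  projections.
\<close>
lemma residual_of_finite_projection:
  assumes "orthonormal_or_zero d p" "orthonormal_or_zero K e"
  shows "\<exists>c. (\<forall>a<K. \<forall>b<K. \<bar>c a b\<bar> \<le> (1::real)) \<and>
    (\<forall>y. (norm (proj K e y - proj d p (proj K e y)))\<^sup>2 =
       (\<Sum>a<K. \<Sum>b<K. c a b * (inner (e a) y * inner (e b) y)))"
proof -
  define r where "r a = e a - proj d p (e a)" for a
  have r: "norm (r a) \<le> 1" if "a < K" for a
    using norm_residual_le[OF assms(1), of "e a"] orthonormal_or_zero_norm[OF assms(2) that]
    unfolding r_def by linarith
  have R: "proj K e y - proj d p (proj K e y) = (\<Sum>a<K. inner (e a) y *\<^sub>R r a)" for y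
  proof -
    have "proj d p (proj K e y) = (\<Sum>a<K. inner (e a) y *\<^sub>R proj d p (e a))"
      unfolding proj_def[of K e] by (simp add: linear_sum[OF linear_proj] linear_scale[OF linear_proj])
    then show ?thesis
      unfolding proj_def[of K e] r_def by (simp add: scaleR_right_diff_distrib sum_subtractf)
  qed
  show ?thesis
  proof (rule exI[of _ "\<lambda>a b. inner (r a) (r b)"], intro conjI allI impI)
    show "\<bar>inner (r a) (r b)\<bar> \<le> 1" if "a < K" "b < K" for a b
      using Cauchy_Schwarz_ineq2[of "r a" "r b"] mult_mono[OF r[OF that(1)] r[OF that(2)]] by simp
    show "(norm (proj K e y - proj d p (proj K e y)))\<^sup>2 =
        (\<Sum>a<K. \<Sum>b<K. inner (r a) (r b) * (inner (e a) y * inner (e b) y))" for y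
      unfolding R power2_norm_eq_inner inner_sum_left inner_sum_right
      by (intro sum.cong) (auto simp: mult_ac inner_commute)
  qed
qed

text \<open>
  The locale is used for the inputs, with \<open>g\<close> the identity, and for the outputs, with \<open>g = \<Psi>\<close>.
  Samples are always drawn in the domain of \<open>g\<close>, so that both uses share one sample space. The
  sequence \<open>e\<close> is the fixed complete system against which PCA is compared.
\<close>
locale fourth_moment_data = prob_space M for M :: "'a measure" +
  fixes g :: "'a \<Rightarrow> 'h::{real_inner, second_countable_topology}"
    and e :: "nat \<Rightarrow> 'h"
  assumes g_measurable: "g \<in> borel_measurable M"
    and fourth_moment: "integrable M (\<lambda>x. norm (g x) ^ 4)"
    and e_orthonormal: "\<And>n. orthonormal_or_zero n e"
    and e_complete: "\<And>y. (\<lambda>n. proj n e y) \<longlonglongrightarrow> y"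
begin

lemma second_moment: "integrable M (\<lambda>x. (norm (g x))\<^sup>2)"
proof (rule Bochner_Integration.integrable_bound)
  show "integrable M (\<lambda>x. 1 + norm (g x) ^ 4)" using fourth_moment by simp
  have "t \<le> 1 + t\<^sup>2" for t :: real
    using zero_le_power2[of "t - 1 / 2"] by (simp add: power2_eq_square algebra_simps)
  from this[of "(norm (g x))\<^sup>2" for x]
  show "AE x in M. norm ((norm (g x))\<^sup>2) \<le> norm (1 + norm (g x) ^ 4)" by simp
qed (use g_measurable in measurable)

lemma proj_measurable [measurable]: "proj n p \<in> borel_measurable borel" for p :: "nat \<Rightarrow> 'h"
  unfolding proj_def by measurable

lemma integrable_if_square_bound:
  fixes h :: "'a \<Rightarrow> real"
  assumes "h \<in> borel_measurable M" "\<And>x. \<bar>h x\<bar> \<le> c * (norm (g x))\<^sup>2"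
  shows "integrable M h"
proof (rule Bochner_Integration.integrable_bound)
  show "integrable M (\<lambda>x. c * (norm (g x))\<^sup>2)" using second_moment by simp
  show "AE x in M. norm (h x) \<le> norm (c * (norm (g x))\<^sup>2)"
    using assms(2) by (auto intro: order_trans[OF _ abs_ge_self])
qed fact

lemma integrable_residual:
  assumes "orthonormal_or_zero d p"
  shows "integrable M (\<lambda>x. (norm (g x - proj d p (g x)))\<^sup>2)"
proof (rule integrable_if_square_bound[where c = 1])
  show "(\<lambda>x. (norm (g x - proj d p (g x)))\<^sup>2) \<in> borel_measurable M"
    using g_measurable by measurable
  show "\<bar>(norm (g x - proj d p (g x)))\<^sup>2\<bar> \<le> 1 * (norm (g x))\<^sup>2" for x
    using norm_residual_le[OF assms, of "g x"] by (simp add: power_mono)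
qed

definition tail :: "nat \<Rightarrow> 'a \<Rightarrow> real" where
  "tail K x = 2 * norm (g x) * norm (g x - proj K e (g x))"

lemma tail_nonneg: "0 \<le> tail K x"
  by (simp add: tail_def)

lemma tail_measurable: "tail K \<in> borel_measurable M"
  unfolding tail_def using g_measurable by measurable

lemma tail_le: "tail K x \<le> 2 * (norm (g x))\<^sup>2"
proof -
  have "norm (g x) * norm (g x - proj K e (g x)) \<le> norm (g x) * norm (g x)"
    using norm_residual_le[OF e_orthonormal[of K], of "g x"] by (intro mult_left_mono) auto
  then show ?thesis by (simp add: tail_def power2_eq_square)
qed

lemma integrable_tail: "integrable M (tail K)"
  using tail_measurable
  by (rule integrable_if_square_bound[where c = 2]) (use tail_le tail_nonneg in simp)

lemma residual_tendsto: "(\<lambda>K. norm (y - proj K e y)) \<longlonglongrightarrow> 0"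
  using tendsto_norm[OF tendsto_diff[OF tendsto_const[of y] e_complete[of y]]] by simp

lemma expected_tail_tendsto: "(\<lambda>K. \<integral>x. tail K x \<partial>M) \<longlonglongrightarrow> 0"
proof -
  have "(\<lambda>K. \<integral>x. tail K x \<partial>M) \<longlonglongrightarrow> (\<integral>x. 0 \<partial>M)"
  proof (rule integral_dominated_convergence[where w = "\<lambda>x. 2 * (norm (g x))\<^sup>2"])
    show "integrable M (\<lambda>x. 2 * (norm (g x))\<^sup>2)" using second_moment by simp
    show "AE x in M. (\<lambda>K. tail K x) \<longlonglongrightarrow> 0"
      unfolding tail_def by (intro AE_I2 tendsto_mult_right_zero residual_tendsto)
    show "AE x in M. norm (tail K x) \<le> 2 * (norm (g x))\<^sup>2" for K
      using tail_le tail_nonneg by simp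
  qed (use tail_measurable in auto)
  then show ?thesis by simp
qed

definition truncation_error :: "nat \<Rightarrow> real" where
  "truncation_error d = (\<integral>x. (norm (g x - proj d e (g x)))\<^sup>2 \<partial>M)"

lemma truncation_error_tendsto: "truncation_error \<longlonglongrightarrow> 0"
proof -
  have "(\<lambda>d. \<integral>x. (norm (g x - proj d e (g x)))\<^sup>2 \<partial>M) \<longlonglongrightarrow> (\<integral>x. 0 \<partial>M)"
  proof (rule integral_dominated_convergence[where w = "\<lambda>x. (norm (g x))\<^sup>2"])
    show "AE x in M. (\<lambda>d. (norm (g x - proj d e (g x)))\<^sup>2) \<longlonglongrightarrow> 0"
      using tendsto_power[OF residual_tendsto, of _ 2] by simp
    show "AE x in M. norm ((norm (g x - proj d e (g x)))\<^sup>2) \<le> (norm (g x))\<^sup>2" for d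
      using norm_residual_le[OF e_orthonormal] by (simp add: power_mono)
  qed (use second_moment borel_measurable_integrable[OF integrable_residual[OF e_orthonormal]] in auto)
  then show ?thesis by (simp add: truncation_error_def[abs_def])
qed

abbreviation avg :: "nat \<Rightarrow> ('a \<Rightarrow> real) \<Rightarrow> (nat \<Rightarrow> 'a) \<Rightarrow> real" where
  "avg N w xs \<equiv> (\<Sum>j<N. w (xs j)) / real N"

definition moment :: "nat \<Rightarrow> nat \<Rightarrow> 'a \<Rightarrow> real" where
  "moment a b x = inner (e a) (g x) * inner (e b) (g x)"

lemma moment_le: "\<bar>moment a b x\<bar> \<le> (norm (g x))\<^sup>2"
proof -
  have *: "\<bar>inner (e c) (g x)\<bar> \<le> norm (g x)" for c
  proof -
    have "\<bar>inner (e c) (g x)\<bar> \<le> norm (e c) * norm (g x)" by (rule Cauchy_Schwarz_ineq2)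
    also have "\<dots> \<le> 1 * norm (g x)"
      using orthonormal_or_zero_norm[OF e_orthonormal[of "Suc c"], of c] by (intro mult_right_mono) auto
    finally show ?thesis by simp
  qed
  show ?thesis
    unfolding moment_def abs_mult power2_eq_square by (intro mult_mono *) auto
qed

lemma moment_measurable: "moment a b \<in> borel_measurable M"
  unfolding moment_def using g_measurable by measurable

lemma integrable_moment: "integrable M (moment a b)"
  using moment_measurable by (rule integrable_if_square_bound[where c = 1]) (simp add: moment_le)

lemma moment_square_le: "(moment a b x)\<^sup>2 \<le> norm (g x) ^ 4"
  using power_mono[OF moment_le abs_ge_zero, of a b x 2] by simp

lemma integrable_moment_square: "integrable M (\<lambda>x. (moment a b x)\<^sup>2)"
  using fourth_moment
  by (rule Bochner_Integration.integrable_bound) (use moment_measurable moment_square_le in auto)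

text \<open>
  A bound for the difference of population and empirical error that mentions no projection:
  \<open>K\<^sup>2\<close> deviations of second moments, and the price of replacing \<open>g\<close> by its projection to the
  first \<open>K\<close> vectors of \<open>e\<close>, paid once under the measure and once under the sample.
\<close>
definition deviation :: "nat \<Rightarrow> nat \<Rightarrow> (nat \<Rightarrow> 'a) \<Rightarrow> real" where
  "deviation K N xs = (\<Sum>a<K. \<Sum>b<K. \<bar>(\<integral>x. moment a b x \<partial>M) - avg N (moment a b) xs\<bar>) +
     (\<integral>x. tail K x \<partial>M) + avg N (tail K) xs"

lemma deviation_nonneg: "0 \<le> deviation K N xs"
  unfolding deviation_def
  by (intro add_nonneg_nonneg sum_nonneg divide_nonneg_nonneg Bochner_Integration.integral_nonneg tail_nonneg) auto

lemma uniform_deviation: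
  assumes p: "orthonormal_or_zero d p"
  shows "(\<integral>x. (norm (g x - proj d p (g x)))\<^sup>2 \<partial>M)
    \<le> avg N (\<lambda>x. (norm (g x - proj d p (g x)))\<^sup>2) xs + deviation K N xs"
proof -
  let ?f = "\<lambda>x. (norm (g x - proj d p (g x)))\<^sup>2"
  let ?h = "\<lambda>x. (norm (proj K e (g x) - proj d p (proj K e (g x))))\<^sup>2"
  obtain c where c: "\<forall>a<K. \<forall>b<K. \<bar>c a b\<bar> \<le> (1::real)"
    and h: "\<forall>y. (norm (proj K e y - proj d p (proj K e y)))\<^sup>2 =
       (\<Sum>a<K. \<Sum>b<K. c a b * (inner (e a) y * inner (e b) y))"
    using residual_of_finite_projection[OF p e_orthonormal[of K]] by blast
  have h: "?h x = (\<Sum>a<K. \<Sum>b<K. c a b * moment a b x)" for x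
    using h unfolding moment_def by simp
  have near: "\<bar>?f x - ?h x\<bar> \<le> tail K x" for x
    unfolding tail_def by (rule residual_perturbation[OF p e_orthonormal])
  have ih: "integrable M ?h"
    unfolding h using integrable_moment by simp
  have Eh: "(\<integral>x. ?h x \<partial>M) = (\<Sum>a<K. \<Sum>b<K. c a b * (\<integral>x. moment a b x \<partial>M))"
    unfolding h using integrable_moment by simp
  have Ah: "avg N ?h xs = (\<Sum>a<K. \<Sum>b<K. c a b * avg N (moment a b) xs)"
  proof -
    have "(\<Sum>j<N. ?h (xs j)) = (\<Sum>a<K. \<Sum>j<N. \<Sum>b<K. c a b * moment a b (xs j))"
      unfolding h by (rule sum.swap)
    also have "\<dots> = (\<Sum>a<K. \<Sum>b<K. \<Sum>j<N. c a b * moment a b (xs j))"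
      by (intro sum.cong refl sum.swap)
    finally show ?thesis by (simp add: sum_divide_distrib sum_distrib_left)
  qed
  have "(\<integral>x. ?f x \<partial>M) \<le> (\<integral>x. ?h x + tail K x \<partial>M)"
    using near by (intro integral_mono integrable_residual p Bochner_Integration.integrable_add ih integrable_tail)
      (metis abs_le_D1 diff_le_eq add.commute)
  also have "\<dots> = (\<integral>x. ?h x \<partial>M) + (\<integral>x. tail K x \<partial>M)"
    using ih integrable_tail by simp
  finally have 1: "(\<integral>x. ?f x \<partial>M) \<le> (\<integral>x. ?h x \<partial>M) + (\<integral>x. tail K x \<partial>M)" .
  have "(\<integral>x. ?h x \<partial>M) - avg N ?h xs =
      (\<Sum>a<K. \<Sum>b<K. c a b * ((\<integral>x. moment a b x \<partial>M) - avg N (moment a b) xs))"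
    unfolding Eh Ah by (simp add: sum_subtractf right_diff_distrib)
  also have "\<dots> \<le> (\<Sum>a<K. \<Sum>b<K. \<bar>(\<integral>x. moment a b x \<partial>M) - avg N (moment a b) xs\<bar>)"
  proof (intro sum_mono)
    fix a b assume "a \<in> {..<K}" "b \<in> {..<K}"
    then have "\<bar>c a b\<bar> * \<bar>(\<integral>x. moment a b x \<partial>M) - avg N (moment a b) xs\<bar>
        \<le> 1 * \<bar>(\<integral>x. moment a b x \<partial>M) - avg N (moment a b) xs\<bar>"
      using c by (intro mult_right_mono) auto
    then show "c a b * ((\<integral>x. moment a b x \<partial>M) - avg N (moment a b) xs)
        \<le> \<bar>(\<integral>x. moment a b x \<partial>M) - avg N (moment a b) xs\<bar>"
      by (simp add: abs_mult[symmetric])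
  qed
  finally have 2: "(\<integral>x. ?h x \<partial>M) - avg N ?h xs
      \<le> (\<Sum>a<K. \<Sum>b<K. \<bar>(\<integral>x. moment a b x \<partial>M) - avg N (moment a b) xs\<bar>)" .
  have "(\<Sum>j<N. ?h (xs j)) \<le> (\<Sum>j<N. ?f (xs j) + tail K (xs j))"
    using near by (intro sum_mono) (metis abs_le_D2 minus_diff_eq diff_le_eq add.commute)
  then have "avg N ?h xs \<le> (\<Sum>j<N. ?f (xs j) + tail K (xs j)) / real N"
    by (intro divide_right_mono) auto
  then have 3: "avg N ?h xs \<le> avg N ?f xs + avg N (tail K) xs"
    by (simp add: sum.distrib add_divide_distrib)
  show ?thesis using 1 2 3 unfolding deviation_def by linarith
qed

lemma expected_deviation:
  assumes "N > 0"
  shows "integrable (PiM {..<N} (\<lambda>_. M)) (deviation K N)"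
    and "(\<integral>xs. deviation K N xs \<partial>PiM {..<N} (\<lambda>_. M))
      \<le> (real K)\<^sup>2 * sqrt ((\<integral>x. norm (g x) ^ 4 \<partial>M) / real N) + 2 * (\<integral>x. tail K x \<partial>M)"
proof -
  let ?D = "PiM {..<N} (\<lambda>_. M)"
  let ?s = "sqrt ((\<integral>x. norm (g x) ^ 4 \<partial>M) / real N)"
  interpret D: prob_space ?D by (intro prob_space_PiM) (rule prob_space_axioms)
  define w where "w a b xs = \<bar>(\<integral>x. moment a b x \<partial>M) - avg N (moment a b) xs\<bar>" for a b xs
  have w: "integrable ?D (w a b)" "(\<integral>xs. w a b xs \<partial>?D) \<le> ?s" for a b
  proof -
    show "integrable ?D (w a b)"
      unfolding w_def
      by (rule mean_deviation_of_average(1)[OF integrable_moment integrable_moment_square assms])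
    have "(\<integral>xs. w a b xs \<partial>?D) \<le> sqrt ((\<integral>x. (moment a b x)\<^sup>2 \<partial>M) / real N)"
      unfolding w_def
      by (rule mean_deviation_of_average(2)[OF integrable_moment integrable_moment_square assms])
    also have "\<dots> \<le> ?s"
      using integral_mono[OF integrable_moment_square fourth_moment moment_square_le]
      by (simp add: divide_right_mono)
    finally show "(\<integral>xs. w a b xs \<partial>?D) \<le> ?s" .
  qed
  have t: "integrable ?D (avg N (tail K))" "(\<integral>xs. avg N (tail K) xs \<partial>?D) = (\<integral>x. tail K x \<partial>M)"
    using PiM_average_integral[OF integrable_tail assms] by auto
  have dev: "deviation K N = (\<lambda>xs. (\<Sum>a<K. \<Sum>b<K. w a b xs) + (\<integral>x. tail K x \<partial>M) + avg N (tail K) xs)"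
    by (simp add: deviation_def w_def fun_eq_iff)
  show "integrable ?D (deviation K N)"
    unfolding dev using w(1) t(1) by simp
  have "(\<integral>xs. deviation K N xs \<partial>?D) =
      (\<Sum>a<K. \<Sum>b<K. \<integral>xs. w a b xs \<partial>?D) + (\<integral>x. tail K x \<partial>M) + (\<integral>x. tail K x \<partial>M)"
    unfolding dev using w(1) t by (simp add: D.prob_space)
  also have "(\<Sum>a<K. \<Sum>b<K. \<integral>xs. w a b xs \<partial>?D) \<le> (\<Sum>a<K. \<Sum>b<K. ?s)"
    using w(2) by (intro sum_mono)
  finally show "(\<integral>xs. deviation K N xs \<partial>?D) \<le> (real K)\<^sup>2 * ?s + 2 * (\<integral>x. tail K x \<partial>M)"
    by (simp add: power2_eq_square)
qed

text \<open>
  First \<open>K\<close> is chosen to control the tails, then the sample size to control the \<open>K\<^sup>2\<close> moments.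
\<close>
lemma deviation_small:
  assumes "\<eta> > 0"
  shows "\<exists>K N0. \<forall>N\<ge>N0. N > 0 \<longrightarrow> (\<integral>xs. deviation K N xs \<partial>PiM {..<N} (\<lambda>_. M)) \<le> \<eta>"
proof -
  have "\<forall>\<^sub>F K in sequentially. (\<integral>x. tail K x \<partial>M) < \<eta> / 4"
    using expected_tail_tendsto assms by (intro order_tendstoD(2)) auto
  then obtain K where K: "(\<integral>x. tail K x \<partial>M) < \<eta> / 4"
    by (auto simp: eventually_sequentially)
  let ?E = "\<integral>x. norm (g x) ^ 4 \<partial>M"
  have "(\<lambda>N. (real K)\<^sup>2 * sqrt (?E / real N)) \<longlonglongrightarrow> (real K)\<^sup>2 * sqrt 0"
    by (intro tendsto_intros lim_const_over_n)
  then have "\<forall>\<^sub>F N in sequentially. (real K)\<^sup>2 * sqrt (?E / real N) < \<eta> / 2"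
    using assms by (intro order_tendstoD(2)) auto
  then obtain N0 where N0: "\<And>N. N \<ge> N0 \<Longrightarrow> (real K)\<^sup>2 * sqrt (?E / real N) < \<eta> / 2"
    by (auto simp: eventually_sequentially)
  have "(\<integral>xs. deviation K N xs \<partial>PiM {..<N} (\<lambda>_. M)) \<le> \<eta>" if "N \<ge> N0" "N > 0" for N
    using expected_deviation(2)[OF that(2), of K] N0[OF that(1)] K by linarith
  then show ?thesis by blast
qed

text \<open>
  \<open>W\<close> is an integrable majorant of the population error, valid for every choice of
  eigenvectors. It takes the place of the error itself, which need not depend measurably on
  the sample.
\<close>
definition pca_error_bound :: "real \<Rightarrow> nat \<Rightarrow> nat \<Rightarrow> ((nat \<Rightarrow> 'a) \<Rightarrow> real) \<Rightarrow> bool" where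
  "pca_error_bound \<eta> d N W \<longleftrightarrow>
    integrable (PiM {..<N} (\<lambda>_. M)) W \<and> (\<forall>xs. 0 \<le> W xs) \<and>
    (\<integral>xs. W xs \<partial>PiM {..<N} (\<lambda>_. M)) \<le> truncation_error d + \<eta> \<and>
    (\<forall>xs p. is_pca_basis N (\<lambda>j. g (xs j)) p \<longrightarrow>
       (\<integral>x. (norm (g x - proj d p (g x)))\<^sup>2 \<partial>M) \<le> W xs)"

text \<open>
  The threshold for \<open>N\<close> depends only on \<open>\<eta>\<close>, not on the rank \<open>d\<close>. The majorant is the
  empirical error of the fixed projection \<open>proj d e\<close>, whose mean is \<open>truncation_error d\<close>, plus
  the uniform deviation.
\<close>
theorem pca_population_error:
  assumes "\<eta> > 0"
  shows "\<exists>N0. \<forall>N\<ge>N0. N > 0 \<longrightarrow> (\<forall>d\<le>N. \<exists>W. pca_error_bound \<eta> d N W)"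
proof -
  obtain K N0 where small: "\<forall>N\<ge>N0. N > 0 \<longrightarrow> (\<integral>xs. deviation K N xs \<partial>PiM {..<N} (\<lambda>_. M)) \<le> \<eta>"
    using deviation_small[OF assms] by blast
  show ?thesis
  proof (rule exI[of _ N0], intro allI impI)
    fix N d assume N: "N0 \<le> N" "0 < N" and d: "d \<le> N"
    let ?D = "PiM {..<N} (\<lambda>_. M)" and ?f = "\<lambda>p x. (norm (g x - proj d p (g x)))\<^sup>2"
    define W where "W xs = avg N (?f e) xs + deviation K N xs" for xs
    have a: "integrable ?D (avg N (?f e))" "(\<integral>xs. avg N (?f e) xs \<partial>?D) = truncation_error d"
      using PiM_average_integral[OF integrable_residual[OF e_orthonormal[of d]] N(2)]
      by (auto simp: truncation_error_def)
    have "integrable ?D W" "(\<integral>xs. W xs \<partial>?D) \<le> truncation_error d + \<eta>"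
      unfolding W_def using a expected_deviation(1)[OF N(2), of K] small N by auto
    moreover have "0 \<le> W xs" for xs
      unfolding W_def using deviation_nonneg
      by (intro add_nonneg_nonneg divide_nonneg_nonneg sum_nonneg) auto
    moreover have "(\<integral>x. ?f p x \<partial>M) \<le> W xs" if pca: "is_pca_basis N (\<lambda>j. g (xs j)) p" for xs p
    proof -
      have p: "orthonormal_or_zero d p"
        using orthonormal_or_zero_mono[OF pca_basis_orthonormal[OF pca] d] .
      have "avg N (?f p) xs \<le> avg N (?f e) xs"
        by (intro divide_right_mono pca_minimises_reconstruction_error[OF pca d e_orthonormal]) simp
      with uniform_deviation[OF p, where N = N and xs = xs and K = K] show ?thesis unfolding W_def by linarith
    qed
    ultimately show "\<exists>W. pca_error_bound \<eta> d N W"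
      unfolding pca_error_bound_def by (intro exI[of _ W]) simp
  qed
qed

end

section \<open>The latent map and its error\<close>

lemma decoder_diff_le:
  assumes "orthonormal_or_zero d p"
  shows "norm (pca_decoder d p s - pca_decoder d p s') \<le> (\<Sum>i<d. \<bar>vec_index s i - vec_index s' i\<bar>)"
proof -
  have "pca_decoder d p s - pca_decoder d p s' = (\<Sum>i<d. (vec_index s i - vec_index s' i) *\<^sub>R p i)"
    by (simp add: pca_decoder_def sum_subtractf scaleR_left_diff_distrib)
  then show ?thesis using norm_sum_orthogonal[OF assms] by simp
qed

lemma decoder_encoder: "pca_decoder d p (pca_encoder d p x) = proj d p x"
  by (simp add: pca_decoder_def pca_encoder_def proj_def inner_commute)

text \<open>
  The latent maps are Lipschitz with the constant of \<open>\<Psi>\<close> for the 1-norm, because the \<open>p i\<close>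
  have norm at most 1. Thus \<open>t\<close> and \<open>r\<close> can be chosen before the bases \<open>p\<close> and \<open>q\<close>.
\<close>
lemma latent_map_network:
  fixes \<Psi> :: "'x::real_inner \<Rightarrow> 'y::real_inner"
  assumes lip: "L-lipschitz_on UNIV \<Psi>" and "\<delta> > 0" "M > 0"
  shows "\<exists>t r. \<forall>p q. orthonormal_or_zero d p \<longrightarrow> orthonormal_or_zero m q \<longrightarrow>
    (\<exists>f\<in>zero_ext_nets d m t r M. \<forall>s\<in>carrier_vec d.
      (s \<in> cube d M \<longrightarrow> (\<forall>j<m. \<bar>vec_index (f s) j - inner (q j) (\<Psi> (pca_decoder d p s))\<bar> \<le> \<delta>)) \<and>
      (s \<notin> cube d M \<longrightarrow> f s = 0\<^sub>v m))"
proof -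
  have L: "L \<ge> 0" using lip by (rule lipschitz_on_nonneg)
  have lipD: "norm (\<Psi> x - \<Psi> y) \<le> L * norm (x - y)" for x y
    using lipschitz_onD[OF lip, of x y] by (simp add: dist_norm)
  \<comment> \<open>A bound for the latent maps on the cube: codes there decode to vectors of norm at most \<open>d * M\<close>.\<close>
  define B where "B = norm (\<Psi> 0) + L * (d * M)"
  obtain t r where net: "\<forall>F.
    (\<forall>s\<in>cube d M. \<forall>s'\<in>cube d M. \<bar>F s - F s'\<bar> \<le> L * (\<Sum>i<d. \<bar>vec_index s i - vec_index s' i\<bar>)) \<longrightarrow>
    (\<forall>s\<in>cube d M. \<bar>F s\<bar> \<le> B) \<longrightarrow>
    (\<exists>t'\<le>t. \<exists>r'\<le>r. \<exists>g\<in>nets d t' r'. \<forall>s\<in>cube d M. \<bar>g s - F s\<bar> \<le> \<delta>)"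
    using relu_nets_approximate_lipschitz[OF assms(2,3) L, of d B] by (elim exE) (rule that)
  show ?thesis
  proof (rule exI[of _ t], rule exI[of _ r], intro allI impI)
    fix p :: "nat \<Rightarrow> 'x" and q :: "nat \<Rightarrow> 'y"
    assume p: "orthonormal_or_zero d p" and q: "orthonormal_or_zero m q"
    define F where "F j s = inner (q j) (\<Psi> (pca_decoder d p s))" for j s
    define good where "good j g \<longleftrightarrow> (\<exists>t'\<le>t. \<exists>r'\<le>r. g \<in> nets d t' r') \<and>
        (\<forall>s\<in>cube d M. \<bar>g s - F j s\<bar> \<le> \<delta>)" for j g
    have "\<exists>g. good j g" if j: "j < m" for j
    proof -
      have qj: "\<bar>inner (q j) y\<bar> \<le> norm y" for y
      proof -
        have "\<bar>inner (q j) y\<bar> \<le> norm (q j) * norm y" by (rule Cauchy_Schwarz_ineq2)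
        also have "\<dots> \<le> 1 * norm y"
          using orthonormal_or_zero_norm[OF q j] by (intro mult_right_mono) auto
        finally show ?thesis by simp
      qed
      have "\<bar>F j s - F j s'\<bar> \<le> L * (\<Sum>i<d. \<bar>vec_index s i - vec_index s' i\<bar>)" for s s'
      proof -
        have "\<bar>F j s - F j s'\<bar> \<le> norm (\<Psi> (pca_decoder d p s) - \<Psi> (pca_decoder d p s'))"
          using qj[of "\<Psi> (pca_decoder d p s) - \<Psi> (pca_decoder d p s')"]
          by (simp add: F_def inner_diff_right)
        also have "\<dots> \<le> L * norm (pca_decoder d p s - pca_decoder d p s')" by (rule lipD)
        also have "\<dots> \<le> L * (\<Sum>i<d. \<bar>vec_index s i - vec_index s' i\<bar>)"
          using L decoder_diff_le[OF p] by (intro mult_left_mono)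
        finally show ?thesis .
      qed
      moreover have "\<bar>F j s\<bar> \<le> B" if s: "s \<in> cube d M" for s
      proof -
        have "\<bar>F j s\<bar> \<le> norm (\<Psi> (pca_decoder d p s))" unfolding F_def by (rule qj)
        also have "\<dots> \<le> norm (\<Psi> 0) + norm (\<Psi> (pca_decoder d p s) - \<Psi> 0)"
          by (rule norm_triangle_sub)
        also have "norm (\<Psi> (pca_decoder d p s) - \<Psi> 0) \<le> L * norm (pca_decoder d p s)"
          using lipD[of "pca_decoder d p s" 0] by simp
        also have "norm (pca_decoder d p s) \<le> (\<Sum>i<d. \<bar>vec_index s i\<bar>)"
          unfolding pca_decoder_def by (rule norm_sum_orthogonal[OF p])
        also have "\<dots> \<le> (\<Sum>i<d. M)"
          using s by (intro sum_mono) (auto simp: cube_def abs_le_iff)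
        finally show ?thesis using L by (simp add: B_def mult_left_mono)
      qed
      ultimately have "\<exists>t'\<le>t. \<exists>r'\<le>r. \<exists>g\<in>nets d t' r'. \<forall>s\<in>cube d M. \<bar>g s - F j s\<bar> \<le> \<delta>"
        using net[THEN spec, of "F j"] by simp
      then show ?thesis unfolding good_def by blast
    qed
    then obtain h where h: "\<And>j. j < m \<Longrightarrow> good j (h j)" by metis
    define g where "g s = Matrix.vec m (\<lambda>j. h j s)" for s
    define f where "f s = (if \<forall>i<d. vec_index s i \<in> {-M..M} then g s else 0\<^sub>v m)" for s
    have "g \<in> stacked_nets d m t r"
      unfolding stacked_nets_def
    proof (intro CollectI conjI ballI allI impI)
      fix j assume j: "j < m"
      then have "(\<lambda>s. vec_index (g s) j) = h j" by (simp add: g_def)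
      then show "\<exists>t'\<le>t. \<exists>r'\<le>r. (\<lambda>s. vec_index (g s) j) \<in> nets d t' r'"
        using h[OF j] by (auto simp: good_def)
    qed (simp add: g_def)
    then have "f \<in> zero_ext_nets d m t r M"
      unfolding zero_ext_nets_def f_def by blast
    moreover have "\<bar>vec_index (f s) j - inner (q j) (\<Psi> (pca_decoder d p s))\<bar> \<le> \<delta>"
      if "s \<in> cube d M" "j < m" for s j
    proof -
      have "f s = g s" using that(1) by (simp add: cube_def f_def)
      then show ?thesis using h[OF that(2)] that by (auto simp: good_def g_def F_def)
    qed
    moreover have "f s = 0\<^sub>v m" if "s \<in> carrier_vec d" "s \<notin> cube d M" for s
      using that by (auto simp: cube_def f_def)
    ultimately show "\<exists>f\<in>zero_ext_nets d m t r M. \<forall>s\<in>carrier_vec d.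
      (s \<in> cube d M \<longrightarrow> (\<forall>j<m. \<bar>vec_index (f s) j - inner (q j) (\<Psi> (pca_decoder d p s))\<bar> \<le> \<delta>)) \<and>
      (s \<notin> cube d M \<longrightarrow> f s = 0\<^sub>v m)"
      by (intro bexI[of _ f]) auto
  qed
qed

lemma square_sum3_le: "(a + b + c)\<^sup>2 \<le> 3 * a\<^sup>2 + 3 * b\<^sup>2 + 3 * (c::real)\<^sup>2"
  using zero_le_power2[of "a - b"] zero_le_power2[of "a - c"] zero_le_power2[of "b - c"]
  by (simp add: power2_eq_square algebra_simps)

text \<open>
  Inside the cube, insert \<open>proj m q (\<Psi> (proj d p x))\<close> and \<open>proj m q (\<Psi> x)\<close>: the three
  resulting errors come from the network, the encoder and the decoder. Outside, some
  coordinate of the code exceeds \<open>M\<close> in absolute value, which forces \<open>norm x > M\<close>, and the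
  zero extension leaves the error \<open>norm (\<Psi> x)\<close>.
\<close>
lemma pointwise_error:
  fixes \<Psi> :: "'x::real_inner \<Rightarrow> 'y::real_inner"
  assumes lip: "L-lipschitz_on UNIV \<Psi>"
    and p: "orthonormal_or_zero d p" and q: "orthonormal_or_zero m q"
    and inside: "\<And>s j. s \<in> cube d M \<Longrightarrow> j < m \<Longrightarrow>
       \<bar>vec_index (f s) j - inner (q j) (\<Psi> (pca_decoder d p s))\<bar> \<le> \<delta>"
    and outside: "\<And>s. s \<in> carrier_vec d \<Longrightarrow> s \<notin> cube d M \<Longrightarrow> f s = 0\<^sub>v m"
  shows "(norm (pca_decoder m q (f (pca_encoder d p x)) - \<Psi> x))\<^sup>2 \<le>
    3 * (m * \<delta>)\<^sup>2 + 3 * L\<^sup>2 * (norm (x - proj d p x))\<^sup>2 + 3 * (norm (\<Psi> x - proj m q (\<Psi> x)))\<^sup>2 +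
    (if norm x > M then (norm (\<Psi> x))\<^sup>2 else 0)"
proof -
  let ?s = "pca_encoder d p x"
  have s: "?s \<in> carrier_vec d" by (simp add: pca_encoder_def)
  show ?thesis
  proof (cases "?s \<in> cube d M")
    case True
    let ?y = "\<Psi> (proj d p x)"
    have "norm (pca_decoder m q (f ?s) - \<Psi> x) \<le> norm (pca_decoder m q (f ?s) - proj m q ?y) +
        norm (proj m q (?y - \<Psi> x)) + norm (proj m q (\<Psi> x) - \<Psi> x)"
      unfolding proj_diff
      using norm_triangle_ineq[of "pca_decoder m q (f ?s) - proj m q ?y" "proj m q ?y - \<Psi> x"]
        norm_triangle_ineq[of "proj m q ?y - proj m q (\<Psi> x)" "proj m q (\<Psi> x) - \<Psi> x"]
      by simp
    also have "norm (pca_decoder m q (f ?s) - proj m q ?y) \<le> m * \<delta>"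
    proof -
      have "pca_decoder m q (f ?s) - proj m q ?y =
          (\<Sum>j<m. (vec_index (f ?s) j - inner (q j) ?y) *\<^sub>R q j)"
        by (simp add: pca_decoder_def proj_def sum_subtractf scaleR_left_diff_distrib)
      then have "norm (pca_decoder m q (f ?s) - proj m q ?y) \<le>
          (\<Sum>j<m. \<bar>vec_index (f ?s) j - inner (q j) ?y\<bar>)"
        using norm_sum_orthogonal[OF q] by simp
      also have "\<dots> \<le> (\<Sum>j<m. \<delta>)"
        using inside[OF True] by (intro sum_mono) (simp add: decoder_encoder)
      finally show ?thesis by simp
    qed
    also have "norm (proj m q (?y - \<Psi> x)) \<le> L * norm (x - proj d p x)"
      using norm_proj_le[OF q, of "?y - \<Psi> x"] lipschitz_onD[OF lip, of "proj d p x" x]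
      by (simp add: dist_norm norm_minus_commute)
    finally have "norm (pca_decoder m q (f ?s) - \<Psi> x) \<le>
        m * \<delta> + L * norm (x - proj d p x) + norm (\<Psi> x - proj m q (\<Psi> x))"
      by (simp add: norm_minus_commute)
    then have "(norm (pca_decoder m q (f ?s) - \<Psi> x))\<^sup>2 \<le>
        (m * \<delta> + L * norm (x - proj d p x) + norm (\<Psi> x - proj m q (\<Psi> x)))\<^sup>2"
      by (intro power_mono) auto
    also have "\<dots> \<le> 3 * (m * \<delta>)\<^sup>2 + 3 * (L * norm (x - proj d p x))\<^sup>2 +
        3 * (norm (\<Psi> x - proj m q (\<Psi> x)))\<^sup>2"
      by (rule square_sum3_le)
    also have "3 * (L * norm (x - proj d p x))\<^sup>2 = 3 * L\<^sup>2 * (norm (x - proj d p x))\<^sup>2"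
      by (simp add: power_mult_distrib)
    finally show ?thesis
      by (rule order_trans) simp
  next
    case False
    then obtain i where i: "i < d" "inner x (p i) \<notin> {-M..M}"
      using s by (auto simp: cube_def pca_encoder_def)
    have "M < \<bar>inner x (p i)\<bar>" using i(2) by auto
    also have "\<dots> \<le> norm x * norm (p i)" by (rule Cauchy_Schwarz_ineq2)
    also have "\<dots> \<le> norm x * 1"
      using orthonormal_or_zero_norm[OF p i(1)] by (intro mult_left_mono) auto
    finally have "norm x > M" by simp
    moreover have "pca_decoder m q (f ?s) = 0"
      using outside[OF s False] by (simp add: pca_decoder_def)
    ultimately show ?thesis by simp
  qed
qed

lemma lipschitz_fourth_moment:
  fixes \<Psi> :: "'x::real_normed_vector \<Rightarrow> 'y::{real_normed_vector, second_countable_topology}"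
  assumes "finite_measure \<mu>" "integrable \<mu> (\<lambda>x. norm x ^ 4)" "\<Psi> \<in> borel_measurable \<mu>"
    and lip: "L-lipschitz_on UNIV \<Psi>"
  shows "integrable \<mu> (\<lambda>x. norm (\<Psi> x) ^ 4)"
proof (rule Bochner_Integration.integrable_bound)
  interpret finite_measure \<mu> by fact
  show "integrable \<mu> (\<lambda>x. 8 * norm (\<Psi> 0) ^ 4 + 8 * L ^ 4 * norm x ^ 4)"
    using assms(2) by simp
  show "(\<lambda>x. norm (\<Psi> x) ^ 4) \<in> borel_measurable \<mu>" using assms(3) by measurable
  have sq: "(a + b)\<^sup>2 \<le> 2 * a\<^sup>2 + 2 * b\<^sup>2" for a b :: real
    using zero_le_power2[of "a - b"] by (simp add: power2_eq_square algebra_simps)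
  have pow4: "(a + b) ^ 4 \<le> 8 * a ^ 4 + 8 * b ^ 4" for a b :: real
  proof -
    have "(a + b) ^ 4 = ((a + b)\<^sup>2)\<^sup>2" by simp
    also have "\<dots> \<le> (2 * a\<^sup>2 + 2 * b\<^sup>2)\<^sup>2" using sq[of a b] by (intro power_mono) auto
    also have "\<dots> \<le> 2 * (2 * a\<^sup>2)\<^sup>2 + 2 * (2 * b\<^sup>2)\<^sup>2" by (rule sq)
    finally show ?thesis by (simp add: power_mult_distrib)
  qed
  have "norm (\<Psi> x) ^ 4 \<le> 8 * norm (\<Psi> 0) ^ 4 + 8 * L ^ 4 * norm x ^ 4" for x
  proof -
    have "norm (\<Psi> x) \<le> norm (\<Psi> 0) + norm (\<Psi> x - \<Psi> 0)" by (rule norm_triangle_sub)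
    also have "norm (\<Psi> x - \<Psi> 0) \<le> L * norm x"
      using lipschitz_onD[OF lip, of x 0] by (simp add: dist_norm)
    finally have "norm (\<Psi> x) ^ 4 \<le> (norm (\<Psi> 0) + L * norm x) ^ 4" by (intro power_mono) auto
    also have "\<dots> \<le> 8 * norm (\<Psi> 0) ^ 4 + 8 * (L * norm x) ^ 4" by (rule pow4)
    finally show ?thesis by (simp add: power_mult_distrib)
  qed
  then show "AE x in \<mu>. norm (norm (\<Psi> x) ^ 4) \<le> norm (8 * norm (\<Psi> 0) ^ 4 + 8 * L ^ 4 * norm x ^ 4)"
    by (intro AE_I2) (simp add: order_trans[OF _ abs_ge_self])
qed

lemma integral_outside_ball_small:
  fixes w :: "'x::{real_normed_vector, second_countable_topology} \<Rightarrow> real"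
  assumes "sets \<mu> = sets borel" "integrable \<mu> w" "\<epsilon> > 0"
  shows "\<exists>M>0. integrable \<mu> (\<lambda>x. if norm x > M then w x else 0) \<and>
    (\<integral>x. (if norm x > M then w x else 0) \<partial>\<mu>) < \<epsilon>"
proof -
  have meas: "(\<lambda>x. if norm x > M then w x else 0) \<in> borel_measurable \<mu>" for M
    using assms(1) borel_measurable_integrable[OF assms(2)]
    by (intro measurable_If) (auto simp: pred_def sets_eq_imp_space_eq[OF assms(1)])
  have "(\<lambda>n. \<integral>x. (if norm x > real n then w x else 0) \<partial>\<mu>) \<longlonglongrightarrow> (\<integral>x. 0 \<partial>\<mu>)"
  proof (rule integral_dominated_convergence[where w = "\<lambda>x. \<bar>w x\<bar>"])
    have "(\<lambda>n. if norm x > real n then w x else 0) \<longlonglongrightarrow> 0" for x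
    proof -
      obtain n0 where "norm x \<le> real n0" using real_arch_simple by blast
      then have "\<forall>\<^sub>F n in sequentially. (if norm x > real n then w x else 0) = 0"
        by (intro eventually_sequentiallyI[of n0]) auto
      then show ?thesis by (rule tendsto_eventually)
    qed
    then show "AE x in \<mu>. (\<lambda>n. if norm x > real n then w x else 0) \<longlonglongrightarrow> 0" by simp
  qed (use assms(2) meas in auto)
  then have "\<forall>\<^sub>F n in sequentially. (\<integral>x. (if norm x > real n then w x else 0) \<partial>\<mu>) < \<epsilon>"
    using assms(3) by (intro order_tendstoD(2)) auto
  then obtain n0 where "\<And>n. n \<ge> n0 \<Longrightarrow> (\<integral>x. (if norm x > real n then w x else 0) \<partial>\<mu>) < \<epsilon>"
    by (auto simp: eventually_sequentially)
  from this[of "Suc n0"] have "(\<integral>x. (if norm x > real (Suc n0) then w x else 0) \<partial>\<mu>) < \<epsilon>" by simp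
  moreover have "integrable \<mu> (\<lambda>x. if norm x > real (Suc n0) then w x else 0)"
    by (rule Bochner_Integration.integrable_bound[OF assms(2) meas]) auto
  ultimately show ?thesis by (intro exI[of _ "real (Suc n0)"]) simp
qed

text \<open>
  A nonmeasurable integrand is handled through an integrable majorant.
\<close>
lemma upper_expectation_le_integral:
  assumes "integrable D G" "\<And>x. x \<in> space D \<Longrightarrow> 0 \<le> G x" "\<And>x. x \<in> space D \<Longrightarrow> F x \<le> ennreal (G x)"
  shows "upper_expectation D F \<le> ennreal (\<integral>x. G x \<partial>D)"
proof -
  have "(\<lambda>x. ennreal (G x)) \<in> borel_measurable D" using assms(1) by simp
  then have "upper_expectation D F \<le> (\<integral>\<^sup>+x. ennreal (G x) \<partial>D)"
    unfolding upper_expectation_def using assms(3) by (intro INF_lower) auto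
  also have "\<dots> = ennreal (\<integral>x. G x \<partial>D)"
    using assms(1,2) by (intro nn_integral_eq_integral AE_I2)
  finally show ?thesis .
qed

lemma expected_network_error:
  fixes \<mu> :: "'x::{real_inner, second_countable_topology} measure"
    and \<Psi> :: "'x \<Rightarrow> 'y::{real_inner, second_countable_topology}"
  assumes X: "fourth_moment_data \<mu> (\<lambda>x. x) eX" and Y: "fourth_moment_data \<mu> \<Psi> eY"
    and lip: "L-lipschitz_on UNIV \<Psi>"
    and p: "orthonormal_or_zero d p" and q: "orthonormal_or_zero m q"
    and tail: "integrable \<mu> (\<lambda>x. if norm x > M then (norm (\<Psi> x))\<^sup>2 else 0)"
    and inside: "\<And>s j. s \<in> cube d M \<Longrightarrow> j < m \<Longrightarrow>
       \<bar>vec_index (f s) j - inner (q j) (\<Psi> (pca_decoder d p s))\<bar> \<le> \<delta>"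
    and outside: "\<And>s. s \<in> carrier_vec d \<Longrightarrow> s \<notin> cube d M \<Longrightarrow> f s = 0\<^sub>v m"
  shows "(\<integral>\<^sup>+x. ennreal ((norm (pca_decoder m q (f (pca_encoder d p x)) - \<Psi> x))\<^sup>2) \<partial>\<mu>) \<le>
    ennreal (3 * (m * \<delta>)\<^sup>2 + 3 * L\<^sup>2 * (\<integral>x. (norm (x - proj d p x))\<^sup>2 \<partial>\<mu>) +
      3 * (\<integral>x. (norm (\<Psi> x - proj m q (\<Psi> x)))\<^sup>2 \<partial>\<mu>) +
      (\<integral>x. (if norm x > M then (norm (\<Psi> x))\<^sup>2 else 0) \<partial>\<mu>))"
proof -
  interpret X: fourth_moment_data \<mu> "\<lambda>x. x" eX by (rule X)
  interpret Y: fourth_moment_data \<mu> \<Psi> eY by (rule Y)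
  let ?B = "\<lambda>x. 3 * (m * \<delta>)\<^sup>2 + 3 * L\<^sup>2 * (norm (x - proj d p x))\<^sup>2 +
    3 * (norm (\<Psi> x - proj m q (\<Psi> x)))\<^sup>2 + (if norm x > M then (norm (\<Psi> x))\<^sup>2 else 0)"
  note ix = X.integrable_residual[OF p] and iy = Y.integrable_residual[OF q]
  have iB: "integrable \<mu> ?B"
    using ix iy tail by (intro Bochner_Integration.integrable_add) auto
  have "(\<integral>\<^sup>+x. ennreal ((norm (pca_decoder m q (f (pca_encoder d p x)) - \<Psi> x))\<^sup>2) \<partial>\<mu>)
      \<le> (\<integral>\<^sup>+x. ennreal (?B x) \<partial>\<mu>)"
    by (intro nn_integral_mono ennreal_leI pointwise_error[OF lip p q inside outside])
  also have "\<dots> = ennreal (\<integral>x. ?B x \<partial>\<mu>)"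
    using iB by (intro nn_integral_eq_integral AE_I2) auto
  also have "(\<integral>x. ?B x \<partial>\<mu>) = 3 * (m * \<delta>)\<^sup>2 + 3 * L\<^sup>2 * (\<integral>x. (norm (x - proj d p x))\<^sup>2 \<partial>\<mu>) +
      3 * (\<integral>x. (norm (\<Psi> x - proj m q (\<Psi> x)))\<^sup>2 \<partial>\<mu>) +
      (\<integral>x. (if norm x > M then (norm (\<Psi> x))\<^sup>2 else 0) \<partial>\<mu>)"
    using ix iy tail by (simp add: X.prob_space)
  finally show ?thesis .
qed

theorem theorem3p1:
  fixes \<mu> :: "'x::{real_inner, polish_space} measure"
    and \<Psi> :: "'x \<Rightarrow> 'y::{real_inner, polish_space}"
  assumes "prob_space \<mu>"
    and "sets \<mu> = sets borel"
    and "integrable \<mu> (\<lambda>x. norm x ^ 4)"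
    and "\<Psi> \<in> borel_measurable \<mu>"
    and "\<exists>L. L-lipschitz_on UNIV \<Psi>"
  shows "\<exists>(dX :: real \<Rightarrow> nat) (dY :: real \<Rightarrow> nat) (N :: nat \<Rightarrow> nat \<Rightarrow> nat).
    \<forall>\<epsilon>>0. let d = dX \<epsilon>; m = dY \<epsilon>; n = N d m; D = PiM {..<n} (\<lambda>_. \<mu>) in
      1 \<le> d \<and> d \<le> n \<and> 1 \<le> m \<and> m \<le> n \<and>
      (\<exists>(t :: nat) (r :: nat) (M :: real). M > 0 \<and>
        (\<forall>\<phi> \<psi>.
          (\<forall>xs\<in>space D. is_pca_basis n xs (\<phi> xs) \<and> is_pca_basis n (\<lambda>j. \<Psi> (xs j)) (\<psi> xs)) \<longrightarrow>
          (\<exists>f. (\<forall>xs\<in>space D. f xs \<in> zero_ext_nets d m t r M) \<and>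
            upper_expectation D (\<lambda>xs. \<integral>\<^sup>+x.
              ennreal ((norm (pca_decoder m (\<psi> xs) (f xs (pca_encoder d (\<phi> xs) x)) - \<Psi> x))\<^sup>2) \<partial>\<mu>)
            < ennreal \<epsilon>)))"
proof -
  obtain L where lip: "L-lipschitz_on UNIV \<Psi>" using assms(5) by blast
  interpret prob_space \<mu> by fact
  obtain eX :: "nat \<Rightarrow> 'x" where eX: "\<And>n. orthonormal_or_zero n eX" "\<And>x. (\<lambda>n. proj n eX x) \<longlonglongrightarrow> x"
    by (rule complete_orthonormal_sequence) blast
  obtain eY :: "nat \<Rightarrow> 'y" where eY: "\<And>n. orthonormal_or_zero n eY" "\<And>x. (\<lambda>n. proj n eY x) \<longlonglongrightarrow> x"
    by (rule complete_orthonormal_sequence) blast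
  interpret X: fourth_moment_data \<mu> "\<lambda>x. x" eX
    by unfold_locales (use eX assms(2,3) in \<open>auto simp: measurable_ident_sets\<close>)
  interpret Y: fourth_moment_data \<mu> \<Psi> eY
    by unfold_locales (use eY assms(4) lipschitz_fourth_moment[OF finite_measure_axioms assms(3,4) lip] in auto)
  \<comment> \<open>The sample size may depend on the dimensions but not on \<open>\<epsilon>\<close>. Hence the permitted statistical
      error is tied to the dimensions, and shrinks as they grow.\<close>
  define \<eta> where "\<eta> d m = 1 / real (Suc (d + m))" for d m :: nat
  have \<eta>_pos: "0 < \<eta> d m" for d m by (simp add: \<eta>_def)
  have "\<exists>N0. \<forall>N\<ge>N0. N > 0 \<longrightarrow> (\<forall>d'\<le>N. \<exists>W. X.pca_error_bound (\<eta> d m) d' N W)" for d m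
    by (rule X.pca_population_error[OF \<eta>_pos])
  then obtain NX where NX: "\<And>d m N d'. N \<ge> NX d m \<Longrightarrow> N > 0 \<Longrightarrow> d' \<le> N \<Longrightarrow> \<exists>W. X.pca_error_bound (\<eta> d m) d' N W"
    by metis
  have "\<exists>N0. \<forall>N\<ge>N0. N > 0 \<longrightarrow> (\<forall>d'\<le>N. \<exists>W. Y.pca_error_bound (\<eta> d m) d' N W)" for d m
    by (rule Y.pca_population_error[OF \<eta>_pos])
  then obtain NY where NY: "\<And>d m N d'. N \<ge> NY d m \<Longrightarrow> N > 0 \<Longrightarrow> d' \<le> N \<Longrightarrow> \<exists>W. Y.pca_error_bound (\<eta> d m) d' N W"
    by metis
  define N where "N d m = Max {1, d, m, NX d m, NY d m}" for d m
  have N: "1 \<le> N d m" "d \<le> N d m" "m \<le> N d m" "NX d m \<le> N d m" "NY d m \<le> N d m" for d m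
    unfolding N_def by (auto intro: Max_ge)
  \<comment> \<open>The part of the error due to PCA when both dimensions equal \<open>k\<close>.\<close>
  define err where "err k = 3 * L\<^sup>2 * (X.truncation_error k + \<eta> k k) + 3 * (Y.truncation_error k + \<eta> k k)" for k
  have "(\<lambda>k. \<eta> k k) \<longlonglongrightarrow> 0"
    using LIMSEQ_subseq_LIMSEQ[OF LIMSEQ_inverse_real_of_nat, of "\<lambda>k. k + k"]
    by (simp add: \<eta>_def strict_mono_def o_def inverse_eq_divide)
  then have "err \<longlonglongrightarrow> 3 * L\<^sup>2 * (0 + 0) + 3 * (0 + 0)"
    unfolding err_def by (intro tendsto_intros X.truncation_error_tendsto Y.truncation_error_tendsto)
  then have "\<exists>k\<ge>1. err k < \<epsilon> / 2" if "\<epsilon> > 0" for \<epsilon> :: real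
  proof -
    have "\<forall>\<^sub>F k in sequentially. err k < \<epsilon> / 2"
      using \<open>err \<longlonglongrightarrow> _\<close> that by (intro order_tendstoD(2)) auto
    then obtain k0 where "\<And>k. k \<ge> k0 \<Longrightarrow> err k < \<epsilon> / 2" by (auto simp: eventually_sequentially)
    from this[of "Suc k0"] show ?thesis by (intro exI[of _ "Suc k0"]) simp
  qed
  then obtain dim where dim: "\<And>\<epsilon>. \<epsilon> > 0 \<Longrightarrow> 1 \<le> dim \<epsilon>" "\<And>\<epsilon>. \<epsilon> > 0 \<Longrightarrow> err (dim \<epsilon>) < \<epsilon> / 2"
    by metis
  show ?thesis
  proof (rule exI[of _ dim], rule exI[of _ dim], rule exI[of _ N], intro allI impI)
    fix \<epsilon> :: real assume \<epsilon>: "\<epsilon> > 0"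
    define k where "k = dim \<epsilon>"
    define n where "n = N k k"
    define D where "D = PiM {..<n} (\<lambda>_. \<mu>)"
    have k: "1 \<le> k" "k \<le> n" "0 < n" using dim(1)[OF \<epsilon>] N[of k k] by (auto simp: k_def n_def)
    obtain W where W: "X.pca_error_bound (\<eta> k k) k n W"
      using NX[of k k n k] N(4)[of k k] k by (auto simp: n_def)
    obtain V where V: "Y.pca_error_bound (\<eta> k k) k n V"
      using NY[of k k n k] N(5)[of k k] k by (auto simp: n_def)
    let ?tail = "\<lambda>M x. if norm x > M then (norm (\<Psi> x))\<^sup>2 else 0"
    obtain M where M: "M > 0" and tail: "integrable \<mu> (?tail M)" "(\<integral>x. ?tail M x \<partial>\<mu>) < \<epsilon> / 8"
      using integral_outside_ball_small[OF assms(2) Y.second_moment, of "\<epsilon> / 8"] \<epsilon> by auto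
    \<comment> \<open>The budget is \<open>\<epsilon> / 2\<close> for PCA, \<open>\<epsilon> / 8\<close> for the network and \<open>\<epsilon> / 8\<close> for large inputs.\<close>
    define \<delta> where "\<delta> = sqrt (\<epsilon> / 24) / real k"
    have \<delta>: "\<delta> > 0" "3 * (k * \<delta>)\<^sup>2 = \<epsilon> / 8" using \<epsilon> k(1) by (auto simp: \<delta>_def)
    obtain t r where net: "\<forall>p q. orthonormal_or_zero k p \<longrightarrow> orthonormal_or_zero k q \<longrightarrow>
      (\<exists>f\<in>zero_ext_nets k k t r M. \<forall>s\<in>carrier_vec k.
        (s \<in> cube k M \<longrightarrow> (\<forall>j<k. \<bar>vec_index (f s) j - inner (q j) (\<Psi> (pca_decoder k p s))\<bar> \<le> \<delta>)) \<and>
        (s \<notin> cube k M \<longrightarrow> f s = 0\<^sub>v k))"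
      using latent_map_network[OF lip \<delta>(1) M, of k k] by (elim exE) (rule that)
    have main: "\<exists>f. (\<forall>xs\<in>space D. f xs \<in> zero_ext_nets k k t r M) \<and>
        upper_expectation D (\<lambda>xs. \<integral>\<^sup>+x.
          ennreal ((norm (pca_decoder k (\<psi> xs) (f xs (pca_encoder k (\<phi> xs) x)) - \<Psi> x))\<^sup>2) \<partial>\<mu>)
        < ennreal \<epsilon>"
      if pca: "\<forall>xs\<in>space D. is_pca_basis n xs (\<phi> xs) \<and> is_pca_basis n (\<lambda>j. \<Psi> (xs j)) (\<psi> xs)" for \<phi> \<psi>
    proof -
      have p: "orthonormal_or_zero k (\<phi> xs)" and q: "orthonormal_or_zero k (\<psi> xs)"
        if "xs \<in> space D" for xs
        using pca that k(2) by (auto intro: orthonormal_or_zero_mono pca_basis_orthonormal)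
      define approx where "approx xs f \<longleftrightarrow> f \<in> zero_ext_nets k k t r M \<and> (\<forall>s\<in>carrier_vec k.
        (s \<in> cube k M \<longrightarrow> (\<forall>j<k. \<bar>vec_index (f s) j - inner (\<psi> xs j) (\<Psi> (pca_decoder k (\<phi> xs) s))\<bar> \<le> \<delta>)) \<and>
        (s \<notin> cube k M \<longrightarrow> f s = 0\<^sub>v k))" for xs f
      have "\<forall>xs\<in>space D. \<exists>f. approx xs f"
        using net p q unfolding approx_def by (simp add: Bex_def)
      then obtain f where f: "\<And>xs. xs \<in> space D \<Longrightarrow> approx xs (f xs)" by metis
      define G where "G xs = \<epsilon> / 8 + 3 * L\<^sup>2 * W xs + 3 * V xs + (\<integral>x. ?tail M x \<partial>\<mu>)" for xs
      interpret D: prob_space D unfolding D_def by (intro prob_space_PiM) (rule prob_space_axioms)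
      have iW: "integrable D W" and iV: "integrable D V"
        using W V by (auto simp: X.pca_error_bound_def Y.pca_error_bound_def D_def)
      have "(\<integral>\<^sup>+x. ennreal ((norm (pca_decoder k (\<psi> xs) (f xs (pca_encoder k (\<phi> xs) x)) - \<Psi> x))\<^sup>2) \<partial>\<mu>)
          \<le> ennreal (G xs)" if xs: "xs \<in> space D" for xs
      proof -
        have "(\<integral>\<^sup>+x. ennreal ((norm (pca_decoder k (\<psi> xs) (f xs (pca_encoder k (\<phi> xs) x)) - \<Psi> x))\<^sup>2) \<partial>\<mu>)
          \<le> ennreal (3 * (k * \<delta>)\<^sup>2 + 3 * L\<^sup>2 * (\<integral>x. (norm (x - proj k (\<phi> xs) x))\<^sup>2 \<partial>\<mu>) +
              3 * (\<integral>x. (norm (\<Psi> x - proj k (\<psi> xs) (\<Psi> x)))\<^sup>2 \<partial>\<mu>) + (\<integral>x. ?tail M x \<partial>\<mu>))"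
          using f[OF xs] by (intro expected_network_error[OF X.fourth_moment_data_axioms
                Y.fourth_moment_data_axioms lip p[OF xs] q[OF xs] tail(1)])
            (auto simp: approx_def cube_def)
        also have "\<dots> \<le> ennreal (G xs)"
        proof (rule ennreal_leI)
          have "(\<integral>x. (norm (x - proj k (\<phi> xs) x))\<^sup>2 \<partial>\<mu>) \<le> W xs"
            using W pca xs by (auto simp: X.pca_error_bound_def)
          then have "3 * L\<^sup>2 * (\<integral>x. (norm (x - proj k (\<phi> xs) x))\<^sup>2 \<partial>\<mu>) \<le> 3 * L\<^sup>2 * W xs"
            by (intro mult_left_mono) auto
          moreover have "(\<integral>x. (norm (\<Psi> x - proj k (\<psi> xs) (\<Psi> x)))\<^sup>2 \<partial>\<mu>) \<le> V xs"
            using V pca xs by (auto simp: Y.pca_error_bound_def)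
          ultimately show "3 * (k * \<delta>)\<^sup>2 + 3 * L\<^sup>2 * (\<integral>x. (norm (x - proj k (\<phi> xs) x))\<^sup>2 \<partial>\<mu>) +
              3 * (\<integral>x. (norm (\<Psi> x - proj k (\<psi> xs) (\<Psi> x)))\<^sup>2 \<partial>\<mu>) + (\<integral>x. ?tail M x \<partial>\<mu>) \<le> G xs"
            unfolding G_def \<delta>(2) by linarith
        qed
        finally show ?thesis .
      qed
      then have "upper_expectation D (\<lambda>xs. \<integral>\<^sup>+x.
          ennreal ((norm (pca_decoder k (\<psi> xs) (f xs (pca_encoder k (\<phi> xs) x)) - \<Psi> x))\<^sup>2) \<partial>\<mu>)
        \<le> ennreal (\<integral>xs. G xs \<partial>D)"
      proof (rule upper_expectation_le_integral[rotated 2])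
        show "integrable D G" unfolding G_def using iW iV by simp
        have "0 \<le> (\<integral>x. ?tail M x \<partial>\<mu>)" by (intro Bochner_Integration.integral_nonneg) auto
        then show "0 \<le> G xs" for xs
          unfolding G_def using W V \<epsilon> by (auto simp: X.pca_error_bound_def Y.pca_error_bound_def intro!: add_nonneg_nonneg)
      qed
      also have "\<dots> < ennreal \<epsilon>"
      proof (rule ennreal_lessI[OF \<epsilon>])
        have "(\<integral>xs. G xs \<partial>D) = \<epsilon> / 8 + 3 * L\<^sup>2 * (\<integral>xs. W xs \<partial>D) + 3 * (\<integral>xs. V xs \<partial>D) +
            (\<integral>x. ?tail M x \<partial>\<mu>)"
          unfolding G_def using iW iV by (simp add: D.prob_space)
        also have "3 * L\<^sup>2 * (\<integral>xs. W xs \<partial>D) \<le> 3 * L\<^sup>2 * (X.truncation_error k + \<eta> k k)"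
          using W by (intro mult_left_mono) (auto simp: X.pca_error_bound_def D_def)
        also have "3 * (\<integral>xs. V xs \<partial>D) \<le> 3 * (Y.truncation_error k + \<eta> k k)"
          using V by (auto simp: Y.pca_error_bound_def D_def)
        finally have "(\<integral>xs. G xs \<partial>D) \<le> \<epsilon> / 8 + err k + (\<integral>x. ?tail M x \<partial>\<mu>)"
          unfolding err_def by simp
        with tail(2) dim(2)[OF \<epsilon>] \<epsilon> show "(\<integral>xs. G xs \<partial>D) < \<epsilon>" unfolding k_def by linarith
      qed
      finally show ?thesis using f by (intro exI[of _ f]) (auto simp: approx_def)
    qed
    show "let d = dim \<epsilon>; m = dim \<epsilon>; n = N d m; D = PiM {..<n} (\<lambda>_. \<mu>) in
      1 \<le> d \<and> d \<le> n \<and> 1 \<le> m \<and> m \<le> n \<and>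
      (\<exists>(t :: nat) (r :: nat) (M :: real). M > 0 \<and>
        (\<forall>\<phi> \<psi>.
          (\<forall>xs\<in>space D. is_pca_basis n xs (\<phi> xs) \<and> is_pca_basis n (\<lambda>j. \<Psi> (xs j)) (\<psi> xs)) \<longrightarrow>
          (\<exists>f. (\<forall>xs\<in>space D. f xs \<in> zero_ext_nets d m t r M) \<and>
            upper_expectation D (\<lambda>xs. \<integral>\<^sup>+x.
              ennreal ((norm (pca_decoder m (\<psi> xs) (f xs (pca_encoder d (\<phi> xs) x)) - \<Psi> x))\<^sup>2) \<partial>\<mu>)
            < ennreal \<epsilon>)))"
      unfolding Let_def k_def[symmetric] n_def[symmetric] D_def[symmetric]
    proof (intro conjI k)
      show "\<exists>t r M. 0 < M \<and> (\<forall>\<phi> \<psi>.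
          (\<forall>xs\<in>space D. is_pca_basis n xs (\<phi> xs) \<and> is_pca_basis n (\<lambda>j. \<Psi> (xs j)) (\<psi> xs)) \<longrightarrow>
          (\<exists>f. (\<forall>xs\<in>space D. f xs \<in> zero_ext_nets k k t r M) \<and>
            upper_expectation D (\<lambda>xs. \<integral>\<^sup>+x.
              ennreal ((norm (pca_decoder k (\<psi> xs) (f xs (pca_encoder k (\<phi> xs) x)) - \<Psi> x))\<^sup>2) \<partial>\<mu>)
            < ennreal \<epsilon>))"
        by (rule exI[of _ t], rule exI[of _ r], rule exI[of _ M], rule conjI[OF M], intro allI impI)
          (rule main)
    qed
  qed
qed

end
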